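(* Let $X$ be a complex Banach space, let $P_1,\dots,P_N$ be orthoprojections in $X$, and let $\mathcal{S}(P_1,\dots,P_N)$ be the convex multiplicative semigroup generated by $P_1,\dots,P_N$, i.e. the convex hull of the multiplicative semigroup consisting of all products with factors from $\{P_1,\dots,P_N\}$. Assume that one of the following conditions is satisfied: (i) $X$ is uniformly convex; (ii) $X$ is uniformly smooth; (iii) $X$ is reflexive and every $P_k$ is of class (D). Then for every $T\in\mathcal{S}(P_1,\dots,P_N)$ the iterates $T^n$ converge strongly, as $n\to\infty$, to an orthoprojection $T^\infty$. In addition, if all $P_k$ are of class (W'), then $$\operatorname{Ran}(T^\infty)=\bigcap_{k\in F_T}\operatorname{Ran}(P_k),\qquad ( * )$$ where $F_T$ is the set of all indices $k$ occurring in the decomposition of $T$ as a member of $\mathcal{S}(P_1,\dots,P_N)$. Moreover, formula $( * )$ holds for arbitrary orthoprojections $P_1,\dots,P_N$ (without assuming that they are of class (W')) if the space $X$ is uniformly convex, or if $X$ is uniformly smooth and strictly convex.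
   Context: A projection in $X$ is a bounded linear operator $P$ on $X$ with $P^2=P$. An orthoprojection is a projection $P$ with $\|P\|\le 1$ (i.e. $\|P\|=1$ or $P=0$). A bounded linear operator $T$ on $X$ is of class (D) if there is $r\in(0,1)$ such that $\|T-rI\|\le 1-r$, where $I$ is the identity operator. A contraction $T$ (i.e. $\|T\|\le 1$) is of class (W') if for every $x\in X$, $\|Tx\|=\|x\|$ implies $Tx=x$. A decomposition of $T$ as a member of $\mathcal{S}(P_1,\dots,P_N)$ is a representation $T=\sum_{j=1}^m\alpha_jW_j$ with $\alpha_j>0$, $\sum_j\alpha_j=1$, where each $W_j$ is a (nonempty finite) product of operators from $\{P_1,\dots,P_N\}$; $F_T$ is the set of indices $k$ such that $P_k$ occurs as a factor in some $W_j$ of the decomposition. A Banach space is strictly convex if all points of its unit sphere are extreme points of the closed unit ball. Strong convergence means convergence in norm at every vector. *)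

theory Defs
  imports "HOL-Analysis.Analysis"
begin

section \<open>Complex Banach spaces\<close>

text \<open>The distribution only has real normed spaces, so the complex scalar multiplication is
  added on top of them, in such a way that it extends the real one.\<close>

class complex_normed_vector = real_normed_vector +
  fixes scaleC :: "complex \<Rightarrow> 'a \<Rightarrow> 'a" (infixr \<open>*\<^sub>C\<close> 75)
  assumes scaleC_add_right: "c *\<^sub>C (x + y) = c *\<^sub>C x + c *\<^sub>C y"
    and scaleC_add_left: "(c + d) *\<^sub>C x = c *\<^sub>C x + d *\<^sub>C x"
    and scaleC_scaleC: "c *\<^sub>C d *\<^sub>C x = (c * d) *\<^sub>C x"
    and scaleC_of_real: "complex_of_real r *\<^sub>C x = r *\<^sub>R x"
    and norm_scaleC: "norm (c *\<^sub>C x) = cmod c * norm x"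

class complex_banach = complex_normed_vector + banach

instantiation complex :: complex_banach
begin

definition scaleC_complex :: "complex \<Rightarrow> complex \<Rightarrow> complex" where
  "scaleC_complex c z = c * z"

instance
  by standard (simp_all add: scaleC_complex_def algebra_simps scaleR_conv_of_real norm_mult)

end

text \<open>Bounded complex linear maps are the elements of \<open>'a \<Rightarrow>\<^sub>L 'b\<close> that commute with complex
  scalars; their operator norm is the one of \<open>'a \<Rightarrow>\<^sub>L 'b\<close>.\<close>

definition complex_linear_op ::
    "('a::complex_normed_vector \<Rightarrow>\<^sub>L 'b::complex_normed_vector) \<Rightarrow> bool" where
  "complex_linear_op A \<longleftrightarrow> (\<forall>c x. blinfun_apply A (c *\<^sub>C x) = c *\<^sub>C blinfun_apply A x)"


section \<open>Geometry of the space\<close>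

definition uniformly_convex_space :: "'a::real_normed_vector itself \<Rightarrow> bool" where
  "uniformly_convex_space _ \<longleftrightarrow>
    (\<forall>\<epsilon>>0. \<exists>\<delta>>0. \<forall>x y :: 'a. norm x = 1 \<and> norm y = 1 \<and> norm (x - y) \<ge> \<epsilon>
      \<longrightarrow> norm ((1/2) *\<^sub>R (x + y)) \<le> 1 - \<delta>)"

text \<open>This is \<open>\<rho>(\<tau>) / \<tau> \<rightarrow> 0\<close> as \<open>\<tau> \<rightarrow> 0\<^sup>+\<close> for the modulus of smoothness
  \<open>\<rho>(\<tau>) = sup {(\<parallel>x + y\<parallel> + \<parallel>x - y\<parallel>) / 2 - 1 | \<parallel>x\<parallel> = 1, \<parallel>y\<parallel> = \<tau>}\<close>, written without the
  supremum, which would be taken over the empty set in the zero space.\<close>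

definition uniformly_smooth_space :: "'a::real_normed_vector itself \<Rightarrow> bool" where
  "uniformly_smooth_space _ \<longleftrightarrow>
    (\<forall>\<epsilon>>0. \<exists>\<delta>>0. \<forall>x y :: 'a. norm x = 1 \<and> norm y \<le> \<delta>
      \<longrightarrow> (norm (x + y) + norm (x - y)) / 2 - 1 \<le> \<epsilon> * norm y)"

definition strictly_convex_space :: "'a::real_normed_vector itself \<Rightarrow> bool" where
  "strictly_convex_space _ \<longleftrightarrow> (\<forall>x \<in> sphere (0::'a) 1. x extreme_point_of cball 0 1)"

definition complex_dual :: "('a::complex_normed_vector \<Rightarrow>\<^sub>L complex) set" where
  "complex_dual = {f. complex_linear_op f}"

text \<open>Elements of the bidual. The functional \<open>blinfun_mult_right c o\<^sub>L f\<close> is \<open>c\<close> times \<open>f\<close>.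
  Values of \<open>\<Phi>\<close> outside the dual are irrelevant.\<close>

definition bidual_functional ::
    "(('a::complex_normed_vector \<Rightarrow>\<^sub>L complex) \<Rightarrow> complex) \<Rightarrow> bool" where
  "bidual_functional \<Phi> \<longleftrightarrow>
    (\<forall>f\<in>complex_dual. \<forall>g\<in>complex_dual. \<Phi> (f + g) = \<Phi> f + \<Phi> g) \<and>
    (\<forall>c. \<forall>f\<in>complex_dual. \<Phi> (blinfun_mult_right c o\<^sub>L f) = c * \<Phi> f) \<and>
    (\<exists>K. \<forall>f\<in>complex_dual. cmod (\<Phi> f) \<le> K * norm f)"

text \<open>The canonical embedding into the bidual is onto.\<close>

definition reflexive_space :: "'a::complex_normed_vector itself \<Rightarrow> bool" where
  "reflexive_space _ \<longleftrightarrow>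
    (\<forall>\<Phi> :: ('a \<Rightarrow>\<^sub>L complex) \<Rightarrow> complex. bidual_functional \<Phi> \<longrightarrow>
      (\<exists>x. \<forall>f\<in>complex_dual. \<Phi> f = blinfun_apply f x))"


section \<open>Classes of operators\<close>

definition orthoprojection :: "('a::complex_normed_vector \<Rightarrow>\<^sub>L 'a) \<Rightarrow> bool" where
  "orthoprojection P \<longleftrightarrow> complex_linear_op P \<and> P o\<^sub>L P = P \<and> norm P \<le> 1"

definition class_D :: "('a::complex_normed_vector \<Rightarrow>\<^sub>L 'a) \<Rightarrow> bool" where
  "class_D T \<longleftrightarrow> complex_linear_op T \<and>
    (\<exists>r. 0 < r \<and> r < 1 \<and> norm (T - r *\<^sub>R id_blinfun) \<le> 1 - r)"

definition class_W' :: "('a::complex_normed_vector \<Rightarrow>\<^sub>L 'a) \<Rightarrow> bool" where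
  "class_W' T \<longleftrightarrow> complex_linear_op T \<and> norm T \<le> 1 \<and>
    (\<forall>x. norm (blinfun_apply T x) = norm x \<longrightarrow> blinfun_apply T x = x)"


section \<open>The convex multiplicative semigroup\<close>

text \<open>A product of the operators \<open>P 1, \<dots>, P N\<close> is given by a word, the list of its indices.\<close>

definition word_product :: "(nat \<Rightarrow> 'a::complex_normed_vector \<Rightarrow>\<^sub>L 'a) \<Rightarrow> nat list \<Rightarrow> 'a \<Rightarrow>\<^sub>L 'a" where
  "word_product P w = foldr (\<lambda>k A. P k o\<^sub>L A) w id_blinfun"

definition words :: "nat \<Rightarrow> nat list set" where
  "words N = {w. w \<noteq> [] \<and> set w \<subseteq> {1..N}}"

definition convex_semigroup ::
    "nat \<Rightarrow> (nat \<Rightarrow> 'a::complex_normed_vector \<Rightarrow>\<^sub>L 'a) \<Rightarrow> ('a \<Rightarrow>\<^sub>L 'a) set" where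
  "convex_semigroup N P = convex hull (word_product P ` words N)"

definition decomposition ::
    "nat \<Rightarrow> (nat \<Rightarrow> 'a::complex_normed_vector \<Rightarrow>\<^sub>L 'a) \<Rightarrow> ('a \<Rightarrow>\<^sub>L 'a) \<Rightarrow>
      nat \<Rightarrow> (nat \<Rightarrow> real) \<Rightarrow> (nat \<Rightarrow> nat list) \<Rightarrow> bool" where
  "decomposition N P T m \<alpha> w \<longleftrightarrow>
    (\<forall>j\<in>{1..m}. \<alpha> j > 0 \<and> w j \<in> words N) \<and> (\<Sum>j=1..m. \<alpha> j) = 1 \<and>
    T = (\<Sum>j=1..m. \<alpha> j *\<^sub>R word_product P (w j))"

definition decomposition_indices :: "nat \<Rightarrow> (nat \<Rightarrow> nat list) \<Rightarrow> nat set" where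
  "decomposition_indices m w = (\<Union>j\<in>{1..m}. set (w j))"

text \<open>The range formula \<open>(*)\<close>. The index set depends on the decomposition of \<open>T\<close>; the formula is
  required for each of them.\<close>

definition range_formula ::
    "nat \<Rightarrow> (nat \<Rightarrow> 'a::complex_normed_vector \<Rightarrow>\<^sub>L 'a) \<Rightarrow> ('a \<Rightarrow>\<^sub>L 'a) \<Rightarrow> ('a \<Rightarrow>\<^sub>L 'a) \<Rightarrow> bool" where
  "range_formula N P T Tinf \<longleftrightarrow>
    (\<forall>m \<alpha> w. decomposition N P T m \<alpha> w \<longrightarrow>
      range (blinfun_apply Tinf) = (\<Inter>k\<in>decomposition_indices m w. range (blinfun_apply (P k))))"

end

theory Submission
  imports Defs
begin

text \<open>For each \<open>x\<close> the iterates \<open>T\<^sup>n x\<close> converge as soon as two things hold: \<open>T\<close> is asymptotically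
  regular, that is \<open>T\<^sup>n x - T\<^sup>n\<^sup>+\<^sup>1 x \<rightarrow> 0\<close> for all \<open>x\<close>; and \<open>x\<close> splits as in the mean ergodic
  theorem into a fixed point \<open>y\<close> of \<open>T\<close> and an element of the closed range of \<open>I - T\<close>. The first
  kills the second part under iteration (\<open>iterates_tendsto_fixed_point\<close>), and the limit
  is the projection onto the fixed space of \<open>T\<close>.

  Asymptotic regularity. In a uniformly convex space an orthoprojection \<open>P\<close> that hardly shortens a
  vector hardly moves it, since \<open>P\<close> maps the midpoint of \<open>x\<close> and \<open>P x\<close> to \<open>P x\<close>
  (\<open>strongly_nonexpansive_projection\<close>). This property, uniform on the unit ball, passes to
  products and convex combinations, hence to \<open>T\<close>, and since the norms along an orbit decrease,
  the steps of the orbit must become short, uniformly on the ball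
  (\<open>strongly_nonexpansive_regular\<close>). In a uniformly smooth space the same is done for the adjoints
  on the uniformly convex dual, and uniformity brings the conclusion back to the space
  (\<open>adjoint_regular\<close>). Class (D) is also stable under products and convex combinations, and means
  that \<open>T\<close> is a proper average of the identity and a contraction; the powers of
  such an average are so spread out that a telescoping sum forces regularity
  (\<open>averaged_regular\<close>).

  The splitting. In a uniformly convex space \<open>y\<close> is the element of least norm in the closed convex
  hull of the orbit (\<open>ergodic_uniformly_convex\<close>). In a reflexive space it represents a generalised
  limit of \<open>f (T\<^sup>n x)\<close> as a function of the functional \<open>f\<close> (\<open>ergodic_reflexive\<close>). A uniformly smooth
  space is reflexive by a Milman--Pettis argument from its uniformly convex dual
  (\<open>real_reflexive_if_dual_uniformly_convex\<close>). All functional analysis is done over the reals,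
  complex reflexivity being transferred once (\<open>real_reflexive_if_reflexive\<close>).

  The range formula. A vector fixed by \<open>T\<close> loses no norm in any of the words of a decomposition,
  hence none in any factor, and class (W') makes it a fixed point of every factor
  (\<open>range_formula_class_W'\<close>). Under uniform or strict convexity all
  orthoprojections are of class (W').\<close>

section \<open>The Hahn--Banach theorem\<close>

text \<open>The functional to be extended is given by its graph \<open>G0\<close>. In this form an extension
  is just a larger subspace of the product space, so that unions of chains are immediate, and a
  functional defined by a limit has as its domain exactly the points where the limit exists.\<close>

lemma hahn_banach_graph:
  fixes p :: "'v::real_vector \<Rightarrow> real" and G0 :: "('v \<times> real) set"
  assumes p_add: "\<And>v w. p (v + w) \<le> p v + p w"
    and p_scale: "\<And>t v. 0 < t \<Longrightarrow> p (t *\<^sub>R v) = t * p v"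
    and G0: "subspace G0" "\<And>v r. (v, r) \<in> G0 \<Longrightarrow> r \<le> p v"
  obtains F where "linear F" "\<And>v. F v \<le> p v" "\<And>v r. (v, r) \<in> G0 \<Longrightarrow> F v = r"
proof -
  define \<G> where "\<G> = {G. subspace G \<and> G0 \<subseteq> G \<and> (\<forall>(v, r)\<in>G. r \<le> p v)}"
  have p0: "p 0 = 0"
    using p_scale[of 2 0] by simp
  have "\<exists>G\<in>\<G>. \<forall>X\<in>\<G>. G \<subseteq> X \<longrightarrow> X = G"
  proof (rule subset_Zorn_nonempty)
    show "\<G> \<noteq> {}"
      using G0 unfolding \<G>_def by auto
    fix \<C> assume ne: "\<C> \<noteq> {}" and ch: "subset.chain \<G> \<C>"
    have in\<G>: "\<C> \<subseteq> \<G>" and lin: "\<And>X Y. X \<in> \<C> \<Longrightarrow> Y \<in> \<C> \<Longrightarrow> X \<subseteq> Y \<or> Y \<subseteq> X"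
      using ch by (auto simp: subset_chain_def)
    have "subspace (\<Union>\<C>)"
    proof (rule subspaceI)
      show "0 \<in> \<Union>\<C>"
        using ne in\<G> subspace_0 by (fastforce simp: \<G>_def)
    next
      fix x y assume "x \<in> \<Union>\<C>" "y \<in> \<Union>\<C>"
      then obtain X where "X \<in> \<C>" "x \<in> X" "y \<in> X"
        using lin by blast
      then show "x + y \<in> \<Union>\<C>"
        using in\<G> by (auto simp: \<G>_def intro: subspace_add)
    next
      fix c :: real and x assume "x \<in> \<Union>\<C>"
      then obtain X where X: "X \<in> \<C>" "x \<in> X"
        by blast
      then have "c *\<^sub>R x \<in> X"
        using in\<G> by (auto simp: \<G>_def intro: subspace_scale)
      then show "c *\<^sub>R x \<in> \<Union>\<C>"
        using X by blast
    qed
    then show "\<Union>\<C> \<in> \<G>"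
      using ne in\<G> by (fastforce simp: \<G>_def)
  qed
  then obtain G where G: "G \<in> \<G>" and max: "\<And>X. X \<in> \<G> \<Longrightarrow> G \<subseteq> X \<Longrightarrow> X = G"
    by blast
  have sub: "subspace G" and "G0 \<subseteq> G" and le: "\<And>v r. (v, r) \<in> G \<Longrightarrow> r \<le> p v"
    using G by (auto simp: \<G>_def)
  have add: "(v + w, r + s) \<in> G" if "(v, r) \<in> G" "(w, s) \<in> G" for v w r s
    using subspace_add[OF sub that] by simp
  have scale: "(t *\<^sub>R v, t * r) \<in> G" if "(v, r) \<in> G" for v r t
    using subspace_scale[OF sub that, of t] by simp
  have unique: "r = s" if "(v, r) \<in> G" "(v, s) \<in> G" for v r s
  proof -
    have "(0, r - s) \<in> G" "(0, s - r) \<in> G"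
      using add[OF that(1) scale[OF that(2), of "-1"]] add[OF that(2) scale[OF that(1), of "-1"]]
      by simp_all
    from le[OF this(1)] le[OF this(2)] show "r = s"
      using p0 by simp
  qed
  have total: "\<exists>r. (x, r) \<in> G" for x
  proof -
    \<comment> \<open>The admissible values at \<open>x\<close> fill an interval; its left end is taken.\<close>
    define c where "c = Sup {r - p (v - x) |v r. (v, r) \<in> G}"
    have gap: "r - p (v - x) \<le> p (w + x) - s" if "(v, r) \<in> G" "(w, s) \<in> G" for v w r s
    proof -
      have "r + s \<le> p (v + w)"
        using le[OF add[OF that]] .
      also have "\<dots> \<le> p (v - x) + p (w + x)"
        using p_add[of "v - x" "w + x"] by simp
      finally show ?thesis
        by simp
    qed
    have zero: "(0, 0) \<in> G"
      using subspace_0[OF sub] by (simp add: zero_prod_def)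
    have lower: "r - p (v - x) \<le> c" if "(v, r) \<in> G" for v r
      unfolding c_def using that gap[OF _ zero] by (intro cSup_upper) (auto intro!: bdd_aboveI)
    have upper: "c \<le> p (w + x) - s" if "(w, s) \<in> G" for w s
      unfolding c_def using zero gap[OF _ that] by (intro cSup_least) auto
    have "span (insert (x, c) G) \<in> \<G>"
    proof -
      have "r \<le> p v" if vr: "(v, r) \<in> span (insert (x, c) G)" for v r
      proof -
        obtain t where t: "(v - t *\<^sub>R x, r - t * c) \<in> G"
          using vr sub by (auto simp: span_insert dest: span_eq_iff[THEN iffD2])
        consider "t = 0" | "t > 0" | "t < 0"
          by linarith
        then show ?thesis
        proof cases
          case 1
          then show ?thesis using le[OF t] by simp
        next
          case 2
          have "c \<le> p ((1/t) *\<^sub>R (v - t *\<^sub>R x) + x) - (1/t) * (r - t * c)"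
            by (rule upper[OF scale[OF t]])
          also have "(1/t) *\<^sub>R (v - t *\<^sub>R x) + x = (1/t) *\<^sub>R v"
            using 2 by (simp add: scaleR_diff_right)
          finally show ?thesis
            using 2 p_scale[of "1/t" v] by (simp add: field_simps)
        next
          case 3
          have "(-1/t) * (r - t * c) - p ((-1/t) *\<^sub>R (v - t *\<^sub>R x) - x) \<le> c"
            by (rule lower[OF scale[OF t]])
          also have "(-1/t) *\<^sub>R (v - t *\<^sub>R x) - x = (-1/t) *\<^sub>R v"
            using 3 by (simp add: scaleR_diff_right)
          finally show ?thesis
            using 3 p_scale[of "-1/t" v] by (simp add: field_simps)
        qed
      qed
      then show ?thesis
        using \<open>G0 \<subseteq> G\<close> span_superset[of "insert (x, c) G"] unfolding \<G>_def by auto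
    qed
    then have "span (insert (x, c) G) = G"
      by (rule max) (meson span_superset subset_insertI subset_trans)
    then show ?thesis
      using span_base[of "(x, c)" "insert (x, c) G"] by auto
  qed
  define F where "F v = (THE r. (v, r) \<in> G)" for v
  have F: "F v = r" if "(v, r) \<in> G" for v r
    unfolding F_def using that unique by blast
  have FG: "(v, F v) \<in> G" for v
    using total[of v] F by auto
  show ?thesis
  proof (rule that)
    show "linear F"
      by (rule linearI) (auto intro!: F add scale FG)
    show "F v \<le> p v" for v
      by (rule le[OF FG])
    show "F v = r" if "(v, r) \<in> G0" for v r
      using F that \<open>G0 \<subseteq> G\<close> by blast
  qed
qed

lemma bounded_extension:
  fixes G0 :: "('v::real_normed_vector \<times> real) set"
  assumes "0 \<le> K" "subspace G0" "\<And>v r. (v, r) \<in> G0 \<Longrightarrow> r \<le> K * norm v"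
  obtains F :: "'v \<Rightarrow>\<^sub>L real"
  where "norm F \<le> K" "\<And>v r. (v, r) \<in> G0 \<Longrightarrow> blinfun_apply F v = r"
proof -
  have "K * norm (v + w) \<le> K * norm v + K * norm w" for v w :: 'v
    using mult_left_mono[OF norm_triangle_ineq assms(1)] by (simp add: distrib_left)
  then obtain f where f: "linear f" "\<And>v. f v \<le> K * norm v" "\<And>v r. (v, r) \<in> G0 \<Longrightarrow> f v = r"
    using hahn_banach_graph[of "\<lambda>v. K * norm v" G0] assms by (auto simp: mult.left_commute)
  have bound: "\<bar>f v\<bar> \<le> K * norm v" for v
    using f(2)[of v] f(2)[of "- v"] linear_neg[OF f(1), of v] by simp
  have "bounded_linear f"
    using f(1) bound by (auto simp: bounded_linear_def bounded_linear_axioms_def mult.commute)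
  then have app: "blinfun_apply (Blinfun f) = f"
    by (rule bounded_linear_Blinfun_apply)
  show ?thesis
    by (rule that[of "Blinfun f"]) (auto simp: app f(3) bound assms(1) intro!: norm_blinfun_bound)
qed

lemma separating_functional:
  fixes M :: "'v::real_normed_vector set"
  assumes M: "subspace M" "closed M" and z: "z \<notin> M"
  obtains F :: "'v \<Rightarrow>\<^sub>L real" where "\<And>v. v \<in> M \<Longrightarrow> blinfun_apply F v = 0" "blinfun_apply F z \<noteq> 0"
proof -
  define G0 where "G0 = {(m + t *\<^sub>R z, t) |m t. m \<in> M}"
  have "open (- M)" "z \<in> - M"
    using M(2) z by auto
  then obtain d where "d > 0" "ball z d \<subseteq> - M"
    using open_contains_ball by blast
  then have d: "d > 0" "\<And>m. m \<in> M \<Longrightarrow> d \<le> dist z m"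
    by (auto simp: subset_iff not_less[symmetric])
  have "subspace G0"
    unfolding G0_def
  proof (rule subspaceI, goal_cases)
    case 1
    then show ?case using subspace_0[OF M(1)] by (auto simp: zero_prod_def intro!: exI[of _ 0])
  next
    case (2 x y)
    then obtain m t n s where "x = (m + t *\<^sub>R z, t)" "y = (n + s *\<^sub>R z, s)" "m \<in> M" "n \<in> M"
      by auto
    then show ?case using subspace_add[OF M(1)]
      by (auto intro!: exI[of _ "m + n"] simp: algebra_simps)
  next
    case (3 c x)
    then obtain m t where "x = (m + t *\<^sub>R z, t)" "m \<in> M"
      by auto
    then show ?case using subspace_scale[OF M(1)]
      by (auto intro!: exI[of _ "c *\<^sub>R m"] simp: algebra_simps)
  qed
  moreover have "r \<le> (1/d) * norm v" if vr: "(v, r) \<in> G0" for v r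
  proof (cases "r > 0")
    case True
    obtain m where m: "m \<in> M" "v = m + r *\<^sub>R z"
      using vr by (auto simp: G0_def)
    have "d \<le> dist z ((-1/r) *\<^sub>R m)"
      by (intro d subspace_scale M m)
    also have "z - (-1/r) *\<^sub>R m = (1/r) *\<^sub>R v"
      using m(2) True by (simp add: scaleR_add_right)
    then have "dist z ((-1/r) *\<^sub>R m) = norm v / r"
      using True by (simp add: dist_norm)
    finally show ?thesis
      using d(1) True by (simp add: field_simps)
  next
    case False
    moreover have "0 \<le> (1/d) * norm v"
      using d(1) by simp
    ultimately show ?thesis
      by linarith
  qed
  ultimately obtain F :: "'v \<Rightarrow>\<^sub>L real" where "norm F \<le> 1/d" and F: "\<And>v r. (v, r) \<in> G0 \<Longrightarrow> blinfun_apply F v = r"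
    using bounded_extension[of "1/d" G0] d(1) by auto
  show ?thesis
  proof (rule that)
    show "blinfun_apply F v = 0" if "v \<in> M" for v
      using that by (intro F) (auto simp: G0_def intro!: exI[of _ v] exI[of _ 0])
    have "blinfun_apply F z = 1"
      using subspace_0[OF M(1)] by (intro F) (auto simp: G0_def)
    then show "blinfun_apply F z \<noteq> 0"
      by simp
  qed
qed

lemma norming_functional:
  fixes z :: "'v::real_normed_vector"
  obtains F :: "'v \<Rightarrow>\<^sub>L real" where "norm F \<le> 1" "blinfun_apply F z = norm z"
proof -
  have eq: "span {(z, norm z)} = range (\<lambda>t. (t *\<^sub>R z, t * norm z))"
    by (auto simp: span_singleton)
  have "r \<le> 1 * norm v" if "(v, r) \<in> span {(z, norm z)}" for v r
    using that unfolding eq by (auto intro!: mult_right_mono)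
  then obtain F :: "'v \<Rightarrow>\<^sub>L real" where F: "norm F \<le> 1"
      "\<And>v r. (v, r) \<in> span {(z, norm z)} \<Longrightarrow> blinfun_apply F v = r"
    using bounded_extension[of 1 "span {(z, norm z)}"] by auto
  show ?thesis
    by (rule that[OF F(1)]) (auto intro!: F(2) span_base)
qed

lemma functionals_separate_points:
  fixes y z :: "'v::real_normed_vector"
  assumes "\<And>F :: 'v \<Rightarrow>\<^sub>L real. blinfun_apply F y = blinfun_apply F z"
  shows "y = z"
proof -
  obtain F :: "'v \<Rightarrow>\<^sub>L real" where "blinfun_apply F (y - z) = norm (y - z)"
    using norming_functional by blast
  then show ?thesis
    using assms[of F] by (simp add: blinfun.diff_right)
qed

section \<open>Contractions and their iterates\<close>

lemma linear_blinfun_apply: "linear (blinfun_apply T)"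
  by (rule bounded_linear.linear[OF blinfun.bounded_linear_right])

lemma blinfun_funpow_diff_in_range:
  fixes T :: "'v::real_normed_vector \<Rightarrow>\<^sub>L 'v"
  shows "x - (blinfun_apply T ^^ n) x \<in> range (\<lambda>z. z - blinfun_apply T z)"
proof (induction n)
  case 0
  then show ?case
    by (auto intro!: image_eqI[of _ _ 0] simp: blinfun.zero_right)
next
  case (Suc n)
  then obtain z where z: "x - (blinfun_apply T ^^ n) x = z - blinfun_apply T z"
    by auto
  have "x - (blinfun_apply T ^^ Suc n) x
      = (z + (blinfun_apply T ^^ n) x) - blinfun_apply T (z + (blinfun_apply T ^^ n) x)"
    using z by (simp add: blinfun.add_right algebra_simps)
  then show ?case
    by blast
qed

lemma funpow_fixed: "h y = y \<Longrightarrow> (h ^^ n) y = y"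
  by (induction n) auto

lemma linear_funpow:
  fixes h :: "'v::real_vector \<Rightarrow> 'v"
  shows "linear h \<Longrightarrow> linear (h ^^ n)"
  by (induction n) (auto intro: linear_compose simp: linear_id[unfolded id_def] id_def)

lemma norm_funpow_le:
  fixes h :: "'v::real_normed_vector \<Rightarrow> 'v"
  shows "(\<And>x. norm (h x) \<le> norm x) \<Longrightarrow> norm ((h ^^ n) x) \<le> norm x"
  by (induction n) (auto intro: order_trans)

lemma norm_blinfun_contraction:
  assumes "norm T \<le> 1"
  shows "norm (blinfun_apply T x) \<le> norm x"
  using norm_blinfun[of T x] mult_right_mono[OF assms norm_ge_zero[of x]] by simp

lemma norm_id_blinfun_le: "norm (id_blinfun :: 'v::real_normed_vector \<Rightarrow>\<^sub>L 'v) \<le> 1"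
  by (rule norm_blinfun_bound) auto

section \<open>Uniform convexity and uniform smoothness\<close>

lemma norm_normalize_diff:
  fixes x :: "'v::real_normed_vector"
  assumes "0 < norm x" "norm x \<le> 1"
  shows "norm (x /\<^sub>R norm x - x) = 1 - norm x"
proof -
  have "x /\<^sub>R norm x - x = (1 / norm x - 1) *\<^sub>R x"
    by (simp add: algebra_simps inverse_eq_divide)
  then have "norm (x /\<^sub>R norm x - x) = \<bar>1 / norm x - 1\<bar> * norm x"
    by simp
  also have "\<dots> = 1 - norm x"
    using assms by (simp add: abs_if field_simps)
  finally show ?thesis .
qed

text \<open>Vectors of the ball whose sum is almost as long as possible are almost unit vectors, so
  they may be normalised at a small cost. This carries uniform convexity from the sphere to the
  ball.\<close>

lemma uniformly_convexD:
  fixes e :: real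
  assumes uc: "uniformly_convex_space TYPE('v::real_normed_vector)" and e: "e > 0"
  obtains d where "d > 0"
    "\<And>x y :: 'v. \<lbrakk>norm x \<le> 1; norm y \<le> 1; norm (x + y) > 2 - d\<rbrakk> \<Longrightarrow> norm (x - y) < e"
proof -
  obtain d0 where d0: "d0 > 0"
    "\<And>x y :: 'v. \<lbrakk>norm x = 1; norm y = 1; norm (x - y) \<ge> e / 2\<rbrakk>
      \<Longrightarrow> norm ((1/2) *\<^sub>R (x + y)) \<le> 1 - d0"
    using uc[unfolded uniformly_convex_space_def, rule_format, of "e/2"] e by auto
  define d where "d = min (1/2) (min (e/4) (d0/2))"
  have d: "d > 0" "d \<le> 1/2" "d \<le> e/4" "d \<le> d0/2"
    using d0(1) e by (auto simp: d_def)
  show ?thesis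
  proof (rule that[OF d(1)])
    fix x y :: 'v
    assume x: "norm x \<le> 1" and y: "norm y \<le> 1" and xy: "norm (x + y) > 2 - d"
    have nx: "norm x > 1 - d" and ny: "norm y > 1 - d"
      using norm_triangle_ineq[of x y] x y xy by linarith+
    define u where "u = x /\<^sub>R norm x"
    define v where "v = y /\<^sub>R norm y"
    have pos: "norm x > 0" "norm y > 0"
      using nx ny d by linarith+
    have u: "norm u = 1" "norm (u - x) < d" and v: "norm v = 1" "norm (v - y) < d"
      using pos norm_normalize_diff[of x] norm_normalize_diff[of y] x y nx ny
      by (simp_all add: u_def v_def)
    have "norm (u - v) < e / 2"
    proof (rule ccontr)
      assume "\<not> norm (u - v) < e / 2"
      then have "norm ((1/2) *\<^sub>R (u + v)) \<le> 1 - d0"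
        using d0(2)[OF u(1) v(1)] by simp
      then have "norm (u + v) \<le> 2 - 2 * d0"
        by simp
      moreover have "norm (x + y) \<le> norm (u + v) + norm (u - x) + norm (v - y)"
        using norm_triangle_ineq4[of "u + v" "(u - x) + (v - y)"]
          norm_triangle_ineq[of "u - x" "v - y"] by (simp add: algebra_simps)
      ultimately show False
        using u(2) v(2) xy d by linarith
    qed
    moreover have "norm (x - y) \<le> norm (u - v) + norm (u - x) + norm (v - y)"
      using norm_triangle_ineq4[of "u - v" "(u - x) - (v - y)"]
        norm_triangle_ineq4[of "u - x" "v - y"] by (simp add: algebra_simps)
    ultimately show "norm (x - y) < e"
      using u(2) v(2) d by linarith
  qed
qed

lemma functional_almost_norming:
  fixes f :: "'v::real_normed_vector \<Rightarrow>\<^sub>L real"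
  assumes "0 \<le> a" "a < norm f"
  obtains x where "norm x = 1" "a < blinfun_apply f x"
proof -
  obtain y where y: "a * norm y < \<bar>blinfun_apply f y\<bar>"
    using norm_blinfun_bound[of a f] assms by (auto simp: not_le[symmetric])
  then have "y \<noteq> 0"
    by auto
  define x where "x = (sgn (blinfun_apply f y) / norm y) *\<^sub>R y"
  have "blinfun_apply f y \<noteq> 0"
    using y assms(1) by (metis abs_zero mult_nonneg_nonneg norm_ge_zero not_le)
  then have "norm x = 1"
    using \<open>y \<noteq> 0\<close> by (simp add: x_def abs_sgn_eq)
  moreover have "blinfun_apply f x = \<bar>blinfun_apply f y\<bar> / norm y"
    by (simp add: x_def blinfun.scaleR_right abs_sgn mult.commute)
  then have "a < blinfun_apply f x"
    using y \<open>y \<noteq> 0\<close> by (simp add: pos_less_divide_eq)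
  ultimately show ?thesis
    by (rule that)
qed

text \<open>For a unit vector \<open>x\<close> and any \<open>y\<close>,
  \<open>(f + g) x + (f - g) y = f (x + y) + g (x - y) \<le> \<parallel>x + y\<parallel> + \<parallel>x - y\<parallel>\<close>,
  and the right-hand side exceeds \<open>2\<close> by little when \<open>y\<close> is short. If \<open>y\<close> points in a
  direction in which \<open>f - g\<close> is large, \<open>(f + g) x\<close> has to stay below \<open>2\<close>.\<close>

lemma uniformly_convex_dual:
  assumes us: "uniformly_smooth_space TYPE('v::real_normed_vector)"
  shows "uniformly_convex_space TYPE('v \<Rightarrow>\<^sub>L real)"
  unfolding uniformly_convex_space_def
proof (intro allI impI)
  fix e :: real assume e: "e > 0"
  obtain d where d: "d > 0" "\<And>x y :: 'v. \<lbrakk>norm x = 1; norm y \<le> d\<rbrakk>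
      \<Longrightarrow> (norm (x + y) + norm (x - y)) / 2 - 1 \<le> (e/8) * norm y"
    using us[unfolded uniformly_smooth_space_def, rule_format, of "e/8"] e by auto
  have "norm ((1/2) *\<^sub>R (f + g)) \<le> 1 - e * d / 8"
    if f: "norm f = 1" and g: "norm g = 1" and fg: "e \<le> norm (f - g)" for f g :: "'v \<Rightarrow>\<^sub>L real"
  proof -
    obtain y0 where y0: "norm y0 = 1" "e / 2 < blinfun_apply (f - g) y0"
      using functional_almost_norming[of "e/2" "f - g"] fg e by auto
    define y where "y = d *\<^sub>R y0"
    have ny: "norm y = d"
      using y0(1) d(1) by (simp add: y_def)
    have "blinfun_apply (f - g) y \<ge> d * (e / 2)"
      using mult_left_mono[OF less_imp_le[OF y0(2)] less_imp_le[OF d(1)]]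
      by (simp add: y_def blinfun.scaleR_right)
    then have big: "blinfun_apply f y - blinfun_apply g y \<ge> e * d / 2"
      by (simp add: blinfun.diff_left mult.commute)
    have unit: "blinfun_apply (f + g) x \<le> 2 - e * d / 4" if x: "norm x = 1" for x
    proof -
      have "blinfun_apply f (x + y) \<le> norm (x + y)" "blinfun_apply g (x - y) \<le> norm (x - y)"
        using norm_blinfun[of f "x + y"] norm_blinfun[of g "x - y"] f g by auto
      moreover have "norm (x + y) + norm (x - y) \<le> 2 + e * d / 4"
        using d(2)[OF x, of y] ny by (simp add: field_simps)
      ultimately show ?thesis
        using big by (simp add: blinfun.add_left blinfun.add_right blinfun.diff_right)
    qed
    have abs_unit: "\<bar>blinfun_apply (f + g) x\<bar> \<le> 2 - e * d / 4" if "norm x = 1" for x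
      using unit[of x] unit[of "- x"] that by (simp add: blinfun.minus_right)
    have bound: "norm (blinfun_apply (f + g) x) \<le> (2 - e * d / 4) * norm x" for x
    proof (cases "x = 0")
      case False
      then show ?thesis
        using abs_unit[of "x /\<^sub>R norm x"] 
        by (simp add: blinfun.scaleR_right abs_mult field_simps)
    qed simp
    have "2 - e * d / 4 \<ge> 0"
      using abs_unit[of "y /\<^sub>R norm y"] ny d(1) by fastforce
    then have "norm (f + g) \<le> 2 - e * d / 4"
      using bound by (intro norm_blinfun_bound)
    then show ?thesis
      by (simp add: mult.commute)
  qed
  then show "\<exists>\<delta>>0. \<forall>x y :: 'v \<Rightarrow>\<^sub>L real. norm x = 1 \<and> norm y = 1 \<and> e \<le> norm (x - y) \<longrightarrow>
      norm ((1/2) *\<^sub>R (x + y)) \<le> 1 - \<delta>"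
    using e d(1) by (intro exI[of _ "e * d / 8"]) auto
qed

section \<open>Strongly nonexpansive maps\<close>

text \<open>The strong nonexpansiveness of Bruck and Reich for linear maps; in terms of sequences, \<open>\<parallel>x\<^sub>n\<parallel> \<le> 1\<close> and
  \<open>\<parallel>x\<^sub>n\<parallel> - \<parallel>h x\<^sub>n\<parallel> \<rightarrow> 0\<close> imply \<open>x\<^sub>n - h x\<^sub>n \<rightarrow> 0\<close>. Plain maps are used instead of
  bounded operators, so that the notion applies verbatim to \<open>f \<mapsto> f o\<^sub>L T\<close> on the dual.\<close>

definition strongly_nonexpansive :: "('v::real_normed_vector \<Rightarrow> 'v) \<Rightarrow> bool" where
  "strongly_nonexpansive h \<longleftrightarrow> linear h \<and> (\<forall>x. norm (h x) \<le> norm x) \<and>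
    (\<forall>e>0. \<exists>d>0. \<forall>x. norm x \<le> 1 \<and> norm x - norm (h x) < d \<longrightarrow> norm (x - h x) < e)"

lemma strongly_nonexpansiveD:
  assumes "strongly_nonexpansive h" "e > 0"
  obtains d where "d > 0"
    "\<And>x. norm x \<le> 1 \<Longrightarrow> norm x - norm (h x) < d \<Longrightarrow> norm (x - h x) < e"
  using assms unfolding strongly_nonexpansive_def by blast

text \<open>A projection \<open>h\<close> maps \<open>x + h x\<close> to \<open>2 h x\<close>, hence
  \<open>\<parallel>x + h x\<parallel> \<ge> 2 \<parallel>h x\<parallel>\<close>. If \<open>h\<close> hardly shortens \<open>x\<close>, the midpoint of \<open>x\<close> and \<open>h x\<close>
  therefore lies near the sphere, and uniform convexity brings \<open>x\<close> and \<open>h x\<close> together.\<close>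

lemma strongly_nonexpansive_projection:
  fixes h :: "'v::real_normed_vector \<Rightarrow> 'v"
  assumes uc: "uniformly_convex_space TYPE('v)"
    and h: "linear h" "\<And>x. norm (h x) \<le> norm x" "\<And>x. h (h x) = h x"
  shows "strongly_nonexpansive h"
  unfolding strongly_nonexpansive_def
proof (intro conjI allI impI h)
  fix e :: real assume e: "e > 0"
  obtain d where d: "d > 0"
    "\<And>x y :: 'v. \<lbrakk>norm x \<le> 1; norm y \<le> 1; norm (x + y) > 2 - d\<rbrakk> \<Longrightarrow> norm (x - y) < e"
    using uniformly_convexD[OF uc e] by blast
  have "norm (x - h x) < e" if x: "norm x \<le> 1" "norm x - norm (h x) < e * d / 4" for x
  proof (rule ccontr)
    assume far: "\<not> norm (x - h x) < e"
    \<comment> \<open>Short vectors satisfy the claim trivially, so \<open>x\<close> can be normalised with control.\<close>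
    then have nx: "norm x \<ge> e / 2"
      using norm_triangle_ineq4[of x "h x"] h(2)[of x] by linarith
    then have pos: "norm x > 0"
      using e by linarith
    define u where "u = x /\<^sub>R norm x"
    have hu: "h u = h x /\<^sub>R norm x"
      unfolding u_def using linear_scale[OF h(1)] by metis
    have nu: "norm u = 1" "norm (h u) \<le> 1"
      using pos h(2)[of u] by (simp_all add: u_def)
    have "norm x - norm (h x) < norm x * d / 2"
    proof -
      have "e * d / 4 \<le> norm x * d / 2"
        using mult_right_mono[OF nx less_imp_le[OF d(1)]] by (simp add: mult.commute)
      then show ?thesis
        using x(2) by linarith
    qed
    then have "norm (h u) > 1 - d / 2"
      using pos by (simp add: hu field_simps)
    moreover have "2 * norm (h u) = norm (h (u + h u))"
      using linear_add[OF h(1)] h(3) by (simp flip: scaleR_2)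
    then have "2 * norm (h u) \<le> norm (u + h u)"
      using h(2) by metis
    ultimately have "norm (u - h u) < e"
      by (intro d nu) (use nu in simp_all)
    moreover have "norm (u - h u) \<ge> norm (x - h x)"
    proof -
      have "u - h u = (x - h x) /\<^sub>R norm x"
        unfolding hu by (simp add: u_def scaleR_diff_right)
      then have "norm (u - h u) = norm (x - h x) / norm x"
        by (simp add: divide_inverse_commute)
      then show ?thesis
        using pos x(1) by (simp add: pos_le_divide_eq mult_left_le)
    qed
    ultimately show False
      using far by linarith
  qed
  then show "\<exists>d>0. \<forall>x. norm x \<le> 1 \<and> norm x - norm (h x) < d \<longrightarrow> norm (x - h x) < e"
    using e d(1) by (intro exI[of _ "e * d / 4"]) auto
qed

lemma strongly_nonexpansive_comp:
  assumes "strongly_nonexpansive h" "strongly_nonexpansive k"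
  shows "strongly_nonexpansive (\<lambda>x. h (k x))"
  unfolding strongly_nonexpansive_def
proof (intro conjI allI impI)
  have lh: "linear h" and lk: "linear k" and nh: "\<And>x. norm (h x) \<le> norm x"
    and nk: "\<And>x. norm (k x) \<le> norm x"
    using assms by (auto simp: strongly_nonexpansive_def)
  show "linear (\<lambda>x. h (k x))"
    using linear_compose[OF lk lh] by (simp add: o_def)
  show "norm (h (k x)) \<le> norm x" for x
    using nh nk order_trans by blast
  fix e :: real assume "e > 0"
  obtain d1 where d1: "d1 > 0"
      "\<And>x. norm x \<le> 1 \<Longrightarrow> norm x - norm (h x) < d1 \<Longrightarrow> norm (x - h x) < e/2"
    using strongly_nonexpansiveD[OF assms(1), of "e/2"] \<open>e > 0\<close> by auto
  obtain d2 where d2: "d2 > 0"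
      "\<And>x. norm x \<le> 1 \<Longrightarrow> norm x - norm (k x) < d2 \<Longrightarrow> norm (x - k x) < e/2"
    using strongly_nonexpansiveD[OF assms(2), of "e/2"] \<open>e > 0\<close> by auto
  have "norm (x - h (k x)) < e"
    if "norm x \<le> 1" "norm x - norm (h (k x)) < min d1 d2" for x
  proof -
    have "norm (x - k x) < e/2" "norm (k x - h (k x)) < e/2"
      using that nh[of "k x"] nk[of x] by (intro d1(2) d2(2); simp)+
    then show ?thesis
      using norm_triangle_ineq[of "x - k x" "k x - h (k x)"] by simp
  qed
  then show "\<exists>d>0. \<forall>x. norm x \<le> 1 \<and> norm x - norm (h (k x)) < d \<longrightarrow> norm (x - h (k x)) < e"
    using d1(1) d2(1) by (intro exI[of _ "min d1 d2"]) auto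
qed

text \<open>If the average loses little norm, each of the two terms loses little, up to the factors \<open>1/a\<close> and \<open>1/b\<close>, and
  both terms are then close to the same vector \<open>x\<close>.\<close>

lemma strongly_nonexpansive_convex:
  assumes "strongly_nonexpansive h" "strongly_nonexpansive k" "a > 0" "b > 0" "a + b = 1"
  shows "strongly_nonexpansive (\<lambda>x. a *\<^sub>R h x + b *\<^sub>R k x)"
  unfolding strongly_nonexpansive_def
proof (intro conjI allI impI)
  have lh: "linear h" and lk: "linear k" and nh: "\<And>x. norm (h x) \<le> norm x"
    and nk: "\<And>x. norm (k x) \<le> norm x"
    using assms by (auto simp: strongly_nonexpansive_def)
  show "linear (\<lambda>x. a *\<^sub>R h x + b *\<^sub>R k x)"
    by (intro linear_compose_add linear_compose_scale_right lh lk)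
  have tri: "norm (a *\<^sub>R u + b *\<^sub>R v) \<le> a * norm u + b * norm v" for u v :: 'a
    using norm_triangle_ineq[of "a *\<^sub>R u" "b *\<^sub>R v"] assms by simp
  have split: "r = a * r + b * r" for r :: real
    using assms(5) by (metis distrib_right mult_1)
  show "norm (a *\<^sub>R h x + b *\<^sub>R k x) \<le> norm x" for x
    using tri[of "h x" "k x"] mult_left_mono[OF nh[of x], of a] mult_left_mono[OF nk[of x], of b]
      split[of "norm x"] assms by linarith
  fix e :: real assume "e > 0"
  obtain d1 where d1: "d1 > 0"
      "\<And>x. norm x \<le> 1 \<Longrightarrow> norm x - norm (h x) < d1 \<Longrightarrow> norm (x - h x) < e"
    using strongly_nonexpansiveD[OF assms(1), of "e"] \<open>e > 0\<close> by auto
  obtain d2 where d2: "d2 > 0"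
      "\<And>x. norm x \<le> 1 \<Longrightarrow> norm x - norm (k x) < d2 \<Longrightarrow> norm (x - k x) < e"
    using strongly_nonexpansiveD[OF assms(2), of "e"] \<open>e > 0\<close> by auto
  have "norm (x - (a *\<^sub>R h x + b *\<^sub>R k x)) < e"
    if x: "norm x \<le> 1" "norm x - norm (a *\<^sub>R h x + b *\<^sub>R k x) < min (a * d1) (b * d2)" for x
  proof -
    have "a * (norm x - norm (h x)) + b * (norm x - norm (k x)) < min (a * d1) (b * d2)"
      using x(2) tri[of "h x" "k x"] split[of "norm x"] by (simp add: algebra_simps)
    moreover have "a * (norm x - norm (h x)) \<ge> 0" "b * (norm x - norm (k x)) \<ge> 0"
      using nh nk assms by simp_all
    ultimately have "a * (norm x - norm (h x)) < a * d1" "b * (norm x - norm (k x)) < b * d2"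
      by linarith+
    then have "norm (x - h x) < e" "norm (x - k x) < e"
      using assms x by (auto intro!: d1 d2)
    then have "a * norm (x - h x) + b * norm (x - k x) < a * e + b * e"
      using assms by (intro add_strict_mono mult_strict_left_mono)
    moreover have "x - (a *\<^sub>R h x + b *\<^sub>R k x) = a *\<^sub>R (x - h x) + b *\<^sub>R (x - k x)"
    proof -
      have "x = a *\<^sub>R x + b *\<^sub>R x"
        using assms(5) by (metis scaleR_add_left scaleR_one)
      then show ?thesis
        by (simp add: algebra_simps)
    qed
    ultimately show ?thesis
      using tri[of "x - h x" "x - k x"] split[of e] by simp
  qed
  then show "\<exists>d>0. \<forall>x. norm x \<le> 1 \<and> norm x - norm (a *\<^sub>R h x + b *\<^sub>R k x) < d \<longrightarrow>
      norm (x - (a *\<^sub>R h x + b *\<^sub>R k x)) < e"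
    using d1(1) d2(1) assms by (intro exI[of _ "min (a * d1) (b * d2)"]) auto
qed

text \<open>Along an orbit in the unit ball the norm can drop by \<open>d\<close> only finitely often, so among
  the first \<open>n0 > 1/d\<close> steps some step loses less than \<open>d\<close> and hence is short; the steps of a
  contraction never grow again. The uniformity in \<open>x\<close> is what makes the statement survive
  the passage from the dual space to the space itself.\<close>

lemma strongly_nonexpansive_regular:
  assumes h: "strongly_nonexpansive h" and e: "e > 0"
  obtains n0 where "\<And>n x. n \<ge> n0 \<Longrightarrow> norm x \<le> 1 \<Longrightarrow> norm ((h ^^ n) x - (h ^^ Suc n) x) < e"
proof -
  have lin: "linear h" and nh: "\<And>x. norm (h x) \<le> norm x"
    using h by (auto simp: strongly_nonexpansive_def)
  obtain d where d: "d > 0" "\<And>x. norm x \<le> 1 \<Longrightarrow> norm x - norm (h x) < d \<Longrightarrow> norm (x - h x) < e"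
    using strongly_nonexpansiveD[OF h e] by blast
  obtain n0 :: nat where n0: "n0 * d > 1"
    using d(1) ex_less_of_nat_mult by blast
  have orbit: "norm ((h ^^ n) x) \<le> norm x" for n x
    by (induction n) (auto intro: order_trans[OF nh])
  have step: "norm ((h ^^ Suc n) x - (h ^^ Suc (Suc n)) x) \<le> norm ((h ^^ n) x - (h ^^ Suc n) x)" for n x
    using nh[of "(h ^^ n) x - (h ^^ Suc n) x"] by (simp add: linear_diff[OF lin])
  show ?thesis
  proof (rule that)
    fix n and x :: 'a assume n: "n \<ge> n0" and x: "norm x \<le> 1"
    have "\<exists>k<n0. norm ((h ^^ k) x) - norm ((h ^^ Suc k) x) < d"
    proof (rule ccontr)
      assume "\<not> ?thesis"
      then have "(\<Sum>k<n0. norm ((h ^^ k) x) - norm ((h ^^ Suc k) x)) \<ge> (\<Sum>k<n0. d)"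
        by (intro sum_mono) auto
      then have "norm x - norm ((h ^^ n0) x) \<ge> n0 * d"
        unfolding sum_lessThan_telescope'[of "\<lambda>k. norm ((h ^^ k) x)" n0] by simp
      then show False
        using n0 x norm_ge_zero[of "(h ^^ n0) x"] by linarith
    qed
    then obtain k where k: "k < n0" "norm ((h ^^ k) x) - norm ((h ^^ Suc k) x) < d"
      by blast
    have "norm ((h ^^ n) x - (h ^^ Suc n) x) \<le> norm ((h ^^ k) x - (h ^^ Suc k) x)"
      by (rule lift_Suc_antimono_le[where f = "\<lambda>n. norm ((h ^^ n) x - (h ^^ Suc n) x)"])
        (use step k n in auto)
    also have "\<dots> < e"
      using d(2)[of "(h ^^ k) x"] k(2) orbit[of k x] x by simp
    finally show "norm ((h ^^ n) x - (h ^^ Suc n) x) < e" .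
  qed
qed

lemma strongly_nonexpansive_tendsto:
  assumes h: "strongly_nonexpansive h"
  shows "(\<lambda>n. (h ^^ n) x - (h ^^ Suc n) x) \<longlonglongrightarrow> 0"
proof -
  have lin: "linear h"
    using h by (auto simp: strongly_nonexpansive_def)
  define t where "t = 1 / (norm x + 1)"
  have t: "t > 0" "norm (t *\<^sub>R x) \<le> 1"
    by (auto simp: t_def add_nonneg_pos)
  show ?thesis
  proof (rule LIMSEQ_I)
    fix e :: real assume "e > 0"
    then obtain n0 where n0: "\<And>n x. n \<ge> n0 \<Longrightarrow> norm x \<le> 1 \<Longrightarrow> norm ((h ^^ n) x - (h ^^ Suc n) x) < t * e"
      using strongly_nonexpansive_regular[OF h, of "t * e"] t(1) by auto
    have "norm ((h ^^ n) x - (h ^^ Suc n) x) < e" if "n \<ge> n0" for n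
    proof -
      have "(h ^^ n) (t *\<^sub>R x) - (h ^^ Suc n) (t *\<^sub>R x) = t *\<^sub>R ((h ^^ n) x - (h ^^ Suc n) x)"
        by (simp only: linear_scale[OF linear_funpow[OF lin]] scaleR_diff_right)
      then have "t * norm ((h ^^ n) x - (h ^^ Suc n) x) < t * e"
        using n0[OF that t(2)] t(1) by (metis abs_of_pos norm_scaleR)
      then show ?thesis
        using t(1) by simp
    qed
    then show "\<exists>n0. \<forall>n\<ge>n0. norm ((h ^^ n) x - (h ^^ Suc n) x - 0) < e"
      by auto
  qed
qed

text \<open>The adjoint is controlled uniformly on the unit ball of the dual, so evaluating at a
  functional that norms \<open>T\<^sup>n x - T\<^sup>n\<^sup>+\<^sup>1 x\<close> transfers the estimate back.\<close>

lemma adjoint_regular: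
  fixes T :: "'v::real_normed_vector \<Rightarrow>\<^sub>L 'v"
  assumes "strongly_nonexpansive (\<lambda>f :: 'v \<Rightarrow>\<^sub>L real. f o\<^sub>L T)"
  shows "(\<lambda>n. (blinfun_apply T ^^ n) x - (blinfun_apply T ^^ Suc n) x) \<longlonglongrightarrow> 0"
proof (rule LIMSEQ_I)
  fix e :: real assume e: "e > 0"
  define t where "t = e / (norm x + 1)"
  have pos: "norm x + 1 > 0"
    using norm_ge_zero[of x] by linarith
  have t: "t > 0" "t * norm x < e"
    using e pos mult_strict_left_mono[OF less_add_one[of "norm x"] e]
    by (simp_all add: t_def pos_divide_less_eq del: less_add_one)
  let ?h = "\<lambda>f :: 'v \<Rightarrow>\<^sub>L real. f o\<^sub>L T"
  have pow: "blinfun_apply ((?h ^^ n) f) z = blinfun_apply f ((blinfun_apply T ^^ n) z)" for n f z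
    by (induction n arbitrary: z) (simp_all add: funpow_swap1)
  obtain n0 where n0: "\<And>n f. n \<ge> n0 \<Longrightarrow> norm f \<le> 1 \<Longrightarrow> norm ((?h ^^ n) f - (?h ^^ Suc n) f) < t"
    using strongly_nonexpansive_regular[OF assms t(1)] by blast
  have "norm ((blinfun_apply T ^^ n) x - (blinfun_apply T ^^ Suc n) x) < e" if "n \<ge> n0" for n
  proof -
    obtain f :: "'v \<Rightarrow>\<^sub>L real" where f: "norm f \<le> 1"
      "blinfun_apply f ((blinfun_apply T ^^ n) x - (blinfun_apply T ^^ Suc n) x)
        = norm ((blinfun_apply T ^^ n) x - (blinfun_apply T ^^ Suc n) x)"
      using norming_functional .
    have "norm ((blinfun_apply T ^^ n) x - (blinfun_apply T ^^ Suc n) x)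
        = blinfun_apply ((?h ^^ n) f - (?h ^^ Suc n) f) x"
      unfolding f(2)[symmetric] blinfun.diff_left blinfun.diff_right pow ..
    also have "\<dots> \<le> norm ((?h ^^ n) f - (?h ^^ Suc n) f) * norm x"
      using norm_blinfun[of "(?h ^^ n) f - (?h ^^ Suc n) f" x] by simp
    also have "\<dots> \<le> t * norm x"
      using n0[OF that f(1)] by (intro mult_right_mono) auto
    finally show ?thesis
      using t(2) by linarith
  qed
  then show "\<exists>n0. \<forall>n\<ge>n0. norm ((blinfun_apply T ^^ n) x - (blinfun_apply T ^^ Suc n) x - 0) < e"
    by auto
qed

section \<open>Fixed points of contractions with vanishing differences of iterates\<close>

text \<open>On the range of \<open>I - T\<close> the iterates tend to \<open>0\<close> by asymptotic regularity, and the
  uniform bound on \<open>T\<^sup>n\<close> extends this to the closure of the range. So convergence reduces to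
  the splitting \<open>x = y + (x - y)\<close> of the mean ergodic theorem.\<close>

lemma iterates_tendsto_fixed_point:
  fixes T :: "'v::real_normed_vector \<Rightarrow>\<^sub>L 'v"
  assumes T: "norm T \<le> 1"
    and regular: "\<And>x. (\<lambda>n. (blinfun_apply T ^^ n) x - (blinfun_apply T ^^ Suc n) x) \<longlonglongrightarrow> 0"
    and y: "blinfun_apply T y = y" "x - y \<in> closure (range (\<lambda>z. z - blinfun_apply T z))"
  shows "(\<lambda>n. (blinfun_apply T ^^ n) x) \<longlonglongrightarrow> y"
proof -
  note lin = linear_funpow[OF linear_blinfun_apply[of T]]
  have contr: "norm ((blinfun_apply T ^^ n) v) \<le> norm v" for n v
    by (intro norm_funpow_le norm_blinfun_contraction T)
  have "(\<lambda>n. (blinfun_apply T ^^ n) (x - y)) \<longlonglongrightarrow> 0"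
  proof (rule LIMSEQ_I)
    fix e :: real assume e: "e > 0"
    obtain z where z: "norm (x - y - (z - blinfun_apply T z)) < e / 2"
      using y(2)[unfolded closure_approachable, rule_format, of "e/2"] e
      by (auto simp: dist_norm norm_minus_commute)
    obtain n0 where n0: "\<And>n. n \<ge> n0 \<Longrightarrow>
        norm ((blinfun_apply T ^^ n) z - (blinfun_apply T ^^ Suc n) z) < e / 2"
      using LIMSEQ_D[OF regular[of z], of "e/2"] e by auto
    have "norm ((blinfun_apply T ^^ n) (x - y)) < e" if "n \<ge> n0" for n
    proof -
      have eq: "(blinfun_apply T ^^ n) (x - y) =
          (blinfun_apply T ^^ n) (x - y - (z - blinfun_apply T z)) +
          ((blinfun_apply T ^^ n) z - (blinfun_apply T ^^ Suc n) z)"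
        by (simp add: linear_diff[OF lin] funpow_swap1)
      show ?thesis
        unfolding eq
        using norm_triangle_ineq[of "(blinfun_apply T ^^ n) (x - y - (z - blinfun_apply T z))"
            "(blinfun_apply T ^^ n) z - (blinfun_apply T ^^ Suc n) z"]
          contr[of n "x - y - (z - blinfun_apply T z)"] z n0[OF that] by linarith
    qed
    then show "\<exists>n0. \<forall>n\<ge>n0. norm ((blinfun_apply T ^^ n) (x - y) - 0) < e"
      by auto
  qed
  then have "(\<lambda>n. (blinfun_apply T ^^ n) x - y) \<longlonglongrightarrow> 0"
    by (simp add: linear_diff[OF lin] funpow_fixed y(1))
  then show ?thesis
    using LIM_zero_iff by blast
qed

lemma least_norm_element:
  fixes C :: "'v::banach set"
  assumes uc: "uniformly_convex_space TYPE('v)" and C: "convex C" "closed C" "C \<noteq> {}"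
  obtains y where "y \<in> C" "\<And>z. z \<in> C \<Longrightarrow> norm z \<le> norm y \<Longrightarrow> z = y"
proof -
  define d where "d = Inf (norm ` C)"
  have bdd: "bdd_below (norm ` C)"
    by (intro bdd_belowI[of _ 0]) auto
  have d_le: "d \<le> norm y" if "y \<in> C" for y
    unfolding d_def using that bdd by (intro cInf_lower) auto
  have d0: "d \<ge> 0"
    unfolding d_def using C(3) by (intro cInf_greatest) auto
  \<comment> \<open>Almost minimal elements are close to each other, because their midpoint is again in \<open>C\<close>.\<close>
  have near: "\<exists>r>0. \<forall>y\<in>C. \<forall>z\<in>C. norm y < d + r \<longrightarrow> norm z < d + r \<longrightarrow> norm (y - z) < e"
    if e: "e > 0" for e :: real
  proof (cases "d = 0")
    case True
    have "norm (y - z) < e" if "norm y < e/2" "norm z < e/2" for y z :: 'v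
      using that norm_triangle_ineq4[of y z] by linarith
    then show ?thesis
      using True e by (intro exI[of _ "e/2"]) auto
  next
    case False
    then have d: "d > 0"
      using d0 by simp
    obtain s where s: "s > 0"
      "\<And>x y :: 'v. \<lbrakk>norm x \<le> 1; norm y \<le> 1; norm (x + y) > 2 - s\<rbrakk> \<Longrightarrow> norm (x - y) < e / (2 * d)"
      using uniformly_convexD[OF uc, of "e / (2 * d)"] d e by auto
    define r where "r = min d (d * s / 4)"
    have r: "r > 0" "r \<le> d" "r \<le> d * s / 4"
      using d s(1) by (auto simp: r_def)
    have "norm (y - z) < e" if yz: "y \<in> C" "z \<in> C" "norm y < d + r" "norm z < d + r" for y z
    proof -
      have pos: "d + r > 0"
        using d r by simp
      have "(1/2) *\<^sub>R y + (1/2) *\<^sub>R z \<in> C"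
        using yz C(1) by (intro convexD) auto
      from d_le[OF this] have "2 * d \<le> norm (y + z)"
        by (simp flip: scaleR_add_right)
      moreover have "(2 - s) * (d + r) < 2 * d"
      proof -
        have "(2 - s) * (d + r) = 2 * d + 2 * r - s * d - s * r"
          by (simp add: algebra_simps)
        moreover have "2 * r \<le> s * d / 2" "s * d > 0" "s * r > 0"
          using r s(1) d by (simp_all add: mult.commute)
        ultimately show ?thesis
          by linarith
      qed
      ultimately have "2 - s < norm (y + z) / (d + r)"
        using pos by (simp add: field_simps)
      then have "norm (y /\<^sub>R (d + r) - z /\<^sub>R (d + r)) < e / (2 * d)"
        using yz(3,4) pos by (intro s(2)) (simp_all add: divide_simps flip: scaleR_add_right)
      moreover have "norm (y /\<^sub>R (d + r) - z /\<^sub>R (d + r)) = norm (y - z) / (d + r)"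
        unfolding scaleR_diff_right[symmetric] using pos by (simp add: divide_inverse_commute)
      ultimately have "norm (y - z) < (e / (2 * d)) * (d + r)"
        using pos_divide_less_eq[OF pos] by metis
      also have "\<dots> \<le> (e / (2 * d)) * (2 * d)"
        using r(2) d e by (intro mult_left_mono) auto
      finally show ?thesis
        using d by simp
    qed
    then show ?thesis
      using r(1) by blast
  qed
  have "\<exists>y\<in>C. norm y < d + 1 / Suc n" for n
  proof -
    have "Inf (norm ` C) < d + 1 / Suc n"
      by (simp add: d_def)
    then show ?thesis
      using C(3) bdd by (subst (asm) cInf_less_iff) auto
  qed
  then obtain u where u: "\<And>n. u n \<in> C" "\<And>n. norm (u n) < d + 1 / Suc n"
    by metis
  have "Cauchy u"
  proof (rule CauchyI)
    fix e :: real assume "e > 0"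
    then obtain r where r: "r > 0"
      "\<And>y z. \<lbrakk>y \<in> C; z \<in> C; norm y < d + r; norm z < d + r\<rbrakk> \<Longrightarrow> norm (y - z) < e"
      using near by meson
    obtain M :: nat where M: "1 / Suc M < r"
      using r(1) nat_approx_posE by blast
    have "norm (u m - u n) < e" if "m \<ge> M" "n \<ge> M" for m n
    proof -
      have "norm (u k) < d + r" if "k \<ge> M" for k
      proof -
        have "1 / Suc k \<le> 1 / Suc M"
          using that by (simp add: frac_le)
        then show ?thesis
          using u(2)[of k] M by linarith
      qed
      then show ?thesis
        using that u(1) by (intro r(2)) auto
    qed
    then show "\<exists>M. \<forall>m\<ge>M. \<forall>n\<ge>M. norm (u m - u n) < e"
      by blast
  qed
  then obtain y where y: "u \<longlonglongrightarrow> y"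
    using Cauchy_convergent_iff convergent_def by blast
  have "y \<in> C"
    using closed_sequentially[OF C(2)] u(1) y by blast
  have "norm y \<le> d"
  proof (rule LIMSEQ_le[OF tendsto_norm[OF y]])
    show "(\<lambda>n. d + 1 / Suc n) \<longlonglongrightarrow> d"
      using tendsto_add[OF tendsto_const LIMSEQ_inverse_real_of_nat, of d]
      by (simp add: inverse_eq_divide)
    show "\<exists>N. \<forall>n\<ge>N. norm (u n) \<le> d + 1 / Suc n"
      using u(2) less_imp_le by blast
  qed
  show ?thesis
  proof (rule that[OF \<open>y \<in> C\<close>])
    fix z assume z: "z \<in> C" "norm z \<le> norm y"
    have "norm (z - y) < e" if e: "e > 0" for e
    proof -
      obtain r where "r > 0"
        "\<And>y z. \<lbrakk>y \<in> C; z \<in> C; norm y < d + r; norm z < d + r\<rbrakk> \<Longrightarrow> norm (y - z) < e"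
        using near[OF e] by meson
      then show ?thesis
        using z \<open>y \<in> C\<close> \<open>norm y \<le> d\<close> by auto
    qed
    then have "norm (z - y) \<le> 0"
      using field_le_epsilon[of "norm (z - y)" 0] less_imp_le by auto
    then show "z = y"
      by simp
  qed
qed

lemma subspace_closure:
  fixes S :: "'v::real_normed_vector set"
  assumes S: "subspace S"
  shows "subspace (closure S)"
proof (rule subspaceI)
  show "0 \<in> closure S"
    using subspace_0[OF S] closure_subset by blast
  fix x y assume "x \<in> closure S" "y \<in> closure S"
  then obtain u v where "\<forall>n. u n \<in> S" "u \<longlonglongrightarrow> x" "\<forall>n. v n \<in> S" "v \<longlonglongrightarrow> y"
    unfolding closure_sequential by blast
  then have "\<forall>n. u n + v n \<in> S" "(\<lambda>n. u n + v n) \<longlonglongrightarrow> x + y"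
    by (auto intro: subspace_add[OF S] tendsto_add)
  then show "x + y \<in> closure S"
    unfolding closure_sequential by (intro exI[of _ "\<lambda>n. u n + v n"]) simp
next
  fix c :: real and x assume "x \<in> closure S"
  then obtain u where "\<forall>n. u n \<in> S" "u \<longlonglongrightarrow> x"
    unfolding closure_sequential by blast
  then have "\<forall>n. c *\<^sub>R u n \<in> S" "(\<lambda>n. c *\<^sub>R u n) \<longlonglongrightarrow> c *\<^sub>R x"
    by (auto intro: subspace_scale[OF S] tendsto_scaleR)
  then show "c *\<^sub>R x \<in> closure S"
    unfolding closure_sequential by (intro exI[of _ "\<lambda>n. c *\<^sub>R u n"]) simp
qed

text \<open>The element of least norm in the closed convex hull of the orbit of \<open>x\<close> is fixed,
  since \<open>T\<close> maps this set into itself without increasing norms. All points of the hull differ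
  from \<open>x\<close> by an element of the closed range of \<open>I - T\<close>, because those of the orbit do.\<close>

lemma ergodic_uniformly_convex:
  fixes T :: "'v::banach \<Rightarrow>\<^sub>L 'v"
  assumes uc: "uniformly_convex_space TYPE('v)" and T: "norm T \<le> 1"
  obtains y where "blinfun_apply T y = y" "x - y \<in> closure (range (\<lambda>z. z - blinfun_apply T z))"
proof -
  let ?R = "range (\<lambda>z. z - blinfun_apply T z)"
  define Orb where "Orb = range (\<lambda>n. (blinfun_apply T ^^ n) x)"
  define C where "C = closure (convex hull Orb)"
  have Orb: "Orb \<noteq> {}" "Orb \<subseteq> C"
    unfolding C_def Orb_def using closure_subset hull_subset by fastforce+
  have C: "convex C" "closed C" "C \<noteq> {}"
    using Orb by (auto simp: C_def convex_closure convex_convex_hull)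
  have C_min: "C \<subseteq> D" if "Orb \<subseteq> D" "convex D" "closed D" for D
    unfolding C_def using that by (intro closure_minimal hull_minimal)
  obtain y where y: "y \<in> C" "\<And>z. z \<in> C \<Longrightarrow> norm z \<le> norm y \<Longrightarrow> z = y"
    using least_norm_element[OF uc C] by blast
  have "C \<subseteq> blinfun_apply T -` C"
  proof (rule C_min)
    show "Orb \<subseteq> blinfun_apply T -` C"
    proof
      fix v assume "v \<in> Orb"
      then obtain n where "v = (blinfun_apply T ^^ n) x"
        by (auto simp: Orb_def)
      then have "blinfun_apply T v = (blinfun_apply T ^^ Suc n) x"
        by simp
      then show "v \<in> blinfun_apply T -` C"
        using Orb(2) unfolding Orb_def by blast
    qed
    show "convex (blinfun_apply T -` C)"
      by (intro convex_linear_vimage linear_blinfun_apply C)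
    show "closed (blinfun_apply T -` C)"
      by (intro continuous_closed_vimage C) (auto intro: linear_continuous_at blinfun.bounded_linear_right)
  qed
  then have "blinfun_apply T y = y"
    using y norm_blinfun_contraction[OF T] by blast
  moreover have "C \<subseteq> (\<lambda>v. x - v) -` closure ?R"
  proof (rule C_min)
    have "subspace ?R"
      by (intro linear_subspace_image[of _ UNIV, simplified] linear_compose_sub linear_id[unfolded id_def]
          linear_blinfun_apply)
    then have sub: "subspace (closure ?R)"
      by (rule subspace_closure)
    show "Orb \<subseteq> (\<lambda>v. x - v) -` closure ?R"
      using blinfun_funpow_diff_in_range[where x = x and T = T] closure_subset[of ?R] by (auto simp: Orb_def)
    show "convex ((\<lambda>v. x - v) -` closure ?R)"
    proof (rule convexI)
      fix v w and a b :: real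
      assume vw: "v \<in> (\<lambda>v. x - v) -` closure ?R" "w \<in> (\<lambda>v. x - v) -` closure ?R"
        and ab: "0 \<le> a" "0 \<le> b" "a + b = 1"
      have "x - (a *\<^sub>R v + b *\<^sub>R w) = a *\<^sub>R (x - v) + b *\<^sub>R (x - w)"
      proof -
        have "x = a *\<^sub>R x + b *\<^sub>R x"
          using ab(3) by (metis scaleR_add_left scaleR_one)
        then show ?thesis
          by (simp add: algebra_simps)
      qed
      then show "a *\<^sub>R v + b *\<^sub>R w \<in> (\<lambda>v. x - v) -` closure ?R"
        using vw sub by (auto intro: subspace_add subspace_scale)
    qed
    show "closed ((\<lambda>v. x - v) -` closure ?R)"
      by (intro continuous_closed_vimage closed_closure) (auto intro!: continuous_intros)
  qed
  ultimately show ?thesis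
    using that y(1) by blast
qed

section \<open>Class (D) and asymptotic regularity\<close>

lemma norm_sum_funpow_le:
  fixes s :: "'v::real_normed_vector \<Rightarrow> 'v"
  assumes "\<And>v. norm (s v) \<le> norm v"
  shows "norm (\<Sum>k<n. (s ^^ (k + m)) y) \<le> n * norm y"
proof -
  have "norm (\<Sum>k<n. (s ^^ (k + m)) y) \<le> (\<Sum>k<n. norm y)"
    by (intro sum_norm_le norm_funpow_le assms)
  then show ?thesis
    by simp
qed

text \<open>The power \<open>h\<^sup>n\<close> of the average \<open>h = r I + (1 - r) s\<close> is a convex combination of
  \<open>I, s, \<dots>, s\<^sup>n\<close> with positive coefficients. Splitting off a small multiple \<open>c\<close> of their plain
  sum leaves a nonnegative combination, whose operator norm is at most its total mass
  \<open>1 - c (n + 1)\<close>.\<close>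

lemma averaged_powers:
  fixes s h :: "'v::real_normed_vector \<Rightarrow> 'v"
  assumes s: "linear s" "\<And>v. norm (s v) \<le> norm v"
    and r: "0 < r" "r < 1" and h: "\<And>v. h v = r *\<^sub>R v + (1 - r) *\<^sub>R s v"
  shows "\<exists>c>0. \<forall>y. norm ((h ^^ n) y - c *\<^sub>R (\<Sum>k<Suc n. (s ^^ k) y)) \<le> (1 - c * (n + 1)) * norm y"
proof (induction n)
  case 0
  then show ?case
    by (intro exI[of _ 1]) simp
next
  case (Suc n)
  then obtain c where c: "c > 0"
    "\<And>y. norm ((h ^^ n) y - c *\<^sub>R (\<Sum>k<Suc n. (s ^^ k) y)) \<le> (1 - c * (n + 1)) * norm y"
    by blast
  define m where "m = min r (1 - r)"
  have m: "m > 0" "m \<le> r" "m \<le> 1 - r"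
    using r by (auto simp: m_def)
  have "norm ((h ^^ Suc n) y - (m * c) *\<^sub>R (\<Sum>k<Suc (Suc n). (s ^^ k) y))
      \<le> (1 - (m * c) * (Suc n + 1)) * norm y" for y
  proof -
    \<comment> \<open>Passing from \<open>n\<close> to \<open>n + 1\<close>, each coefficient of the sum is at least
      \<open>c min(r, 1 - r)\<close>: the terms \<open>r A\<close> and \<open>(1 - r) s A\<close> contribute it at the two ends.\<close>
    define A where "A = (\<Sum>k<Suc n. (s ^^ k) y)"
    define B where "B = (\<Sum>k<n. (s ^^ (k + 1)) y)"
    define R where "R = (h ^^ n) y - c *\<^sub>R A"
    have A: "norm A \<le> (n + 1) * norm y"
      using norm_sum_funpow_le[OF s(2), where n = "Suc n" and m = 0] by (simp add: A_def add.commute)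
    have B: "norm B \<le> n * norm y"
      unfolding B_def by (rule norm_sum_funpow_le[OF s(2)])
    have AB: "A = y + B"
      unfolding A_def B_def by (subst sum.lessThan_Suc_shift) simp
    have sA: "(\<Sum>k<Suc (Suc n). (s ^^ k) y) = y + s A"
      unfolding A_def by (subst sum.lessThan_Suc_shift) (simp add: linear_sum[OF s(1)] linear_add[OF s(1)])
    have R: "norm R \<le> (1 - c * (n + 1)) * norm y"
      using c(2) by (simp add: R_def A_def)
    have hn: "(h ^^ n) y = c *\<^sub>R A + R"
      by (simp add: R_def)
    have "(h ^^ Suc n) y - (m * c) *\<^sub>R (y + s A)
        = (c * (r - m)) *\<^sub>R y + (c * r) *\<^sub>R B + (c * (1 - r - m)) *\<^sub>R s A + (r *\<^sub>R R + (1 - r) *\<^sub>R s R)"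
      by (simp add: hn h linear_add[OF s(1)] linear_scale[OF s(1)] AB algebra_simps)
    also have "norm \<dots> \<le> norm ((c * (r - m)) *\<^sub>R y) + norm ((c * r) *\<^sub>R B)
        + norm ((c * (1 - r - m)) *\<^sub>R s A) + (norm (r *\<^sub>R R) + norm ((1 - r) *\<^sub>R s R))"
      by (intro norm_triangle_le add_mono order_refl)
    also have "\<dots> = c * (r - m) * norm y + c * r * norm B + c * (1 - r - m) * norm (s A)
        + (r * norm R + (1 - r) * norm (s R))"
      using c(1) m r by (simp add: abs_mult)
    also have "\<dots> \<le> c * (r - m) * norm y + c * r * (n * norm y) + c * (1 - r - m) * ((n + 1) * norm y)
        + (r * ((1 - c * (n + 1)) * norm y) + (1 - r) * ((1 - c * (n + 1)) * norm y))"
      using c(1) m r A B R order_trans[OF s(2) A] order_trans[OF s(2) R]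
      by (intro add_mono mult_left_mono) auto
    also have "\<dots> = (1 - (m * c) * (Suc n + 1)) * norm y"
      by (simp add: algebra_simps)
    finally show ?thesis
      by (simp only: sA)
  qed
  then show ?case
    using c(1) m(1) by (intro exI[of _ "m * c"]) auto
qed

text \<open>The norms \<open>\<parallel>h\<^sup>i x - s h\<^sup>i x\<parallel>\<close> decrease to a limit \<open>d\<close>. After \<open>n\<close> further steps the norm is
  still at least \<open>d\<close>, while in the splitting of \<open>averaged_powers\<close> the remainder accounts
  for at most about \<open>(1 - c (n + 1)) d\<close>; so the sum itself has norm at least about
  \<open>(n + 1) d\<close>. But it telescopes and is bounded by
  \<open>2 \<parallel>x\<parallel>\<close> for all \<open>n\<close>. Hence \<open>d = 0\<close>.\<close>

lemma averaged_regular: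
  fixes s h :: "'v::real_normed_vector \<Rightarrow> 'v"
  assumes s: "linear s" "\<And>v. norm (s v) \<le> norm v"
    and r: "0 < r" "r < 1" and h: "\<And>v. h v = r *\<^sub>R v + (1 - r) *\<^sub>R s v"
  shows "(\<lambda>n. (h ^^ n) x - (h ^^ Suc n) x) \<longlonglongrightarrow> 0"
proof -
  define y where "y i = (h ^^ i) x - s ((h ^^ i) x)" for i
  have lin: "linear h"
    unfolding h[abs_def] by (intro linear_compose_add linear_compose_scale_right s linear_id[unfolded id_def])
  have nh: "norm (h v) \<le> norm v" for v
  proof -
    have "norm (h v) \<le> r * norm v + (1 - r) * norm (s v)"
      unfolding h using r norm_triangle_ineq[of "r *\<^sub>R v" "(1 - r) *\<^sub>R s v"] by simp
    also have "\<dots> \<le> r * norm v + (1 - r) * norm v"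
      using r s(2) by (intro add_mono mult_left_mono) auto
    finally show ?thesis
      by (simp add: algebra_simps)
  qed
  have y_Suc: "y (Suc i) = h (y i)" for i
    by (simp add: y_def h linear_add[OF s(1)] linear_diff[OF s(1)] linear_scale[OF s(1)] algebra_simps)
  have y_add: "y (n + i) = (h ^^ n) (y i)" for n i
    by (induction n) (simp_all add: y_Suc)
  have "decseq (\<lambda>i. norm (y i))"
    by (rule decseq_SucI) (simp add: y_Suc nh)
  then obtain d where d: "(\<lambda>i. norm (y i)) \<longlonglongrightarrow> d" "\<And>i. d \<le> norm (y i)"
    using decseq_convergent[of "\<lambda>i. norm (y i)" 0] by auto
  have bound: "d * (n + 1) \<le> 2 * norm x" for n :: nat
  proof -
    obtain c where c: "c > 0"
      "\<And>y. norm ((h ^^ n) y - c *\<^sub>R (\<Sum>k<Suc n. (s ^^ k) y)) \<le> (1 - c * (n + 1)) * norm y"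
      using averaged_powers[OF s r h, where n = n] by blast
    have "d \<le> c * (2 * norm x) + (1 - c * (n + 1)) * norm (y i)" for i
    proof -
      define w where "w = (h ^^ i) x"
      have w: "norm w \<le> norm x"
        unfolding w_def by (intro norm_funpow_le nh)
      have "(s ^^ k) (y i) = (s ^^ k) w - (s ^^ Suc k) w" for k
        unfolding y_def w_def[symmetric]
        using linear_diff[OF linear_funpow[OF s(1)]] by (simp add: funpow_swap1)
      then have "(\<Sum>k<Suc n. (s ^^ k) (y i)) = w - (s ^^ Suc n) w"
        using sum_lessThan_telescope'[of "\<lambda>k. (s ^^ k) w" "Suc n"] by simp
      then have "norm (\<Sum>k<Suc n. (s ^^ k) (y i)) = norm (w - (s ^^ Suc n) w)"
        by (rule arg_cong)
      then have "norm (\<Sum>k<Suc n. (s ^^ k) (y i)) \<le> 2 * norm x"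
        using norm_triangle_ineq4[of w "(s ^^ Suc n) w"] w
          norm_funpow_le[of s "Suc n" w, OF s(2)] by linarith
      then have "norm (c *\<^sub>R (\<Sum>k<Suc n. (s ^^ k) (y i))) \<le> c * (2 * norm x)"
        using c(1) by simp
      moreover have "d \<le> norm ((h ^^ n) (y i))"
        using d(2)[of "n + i"] by (simp add: y_add)
      moreover have "norm ((h ^^ n) (y i)) \<le> norm (c *\<^sub>R (\<Sum>k<Suc n. (s ^^ k) (y i))) +
          norm ((h ^^ n) (y i) - c *\<^sub>R (\<Sum>k<Suc n. (s ^^ k) (y i)))"
        by (metis norm_triangle_sub)
      ultimately show ?thesis
        using c(2)[of "y i"] by linarith
    qed
    then have "d \<le> c * (2 * norm x) + (1 - c * (n + 1)) * d"
      by (intro LIMSEQ_le_const[where X = "\<lambda>i. c * (2 * norm x) + (1 - c * (n + 1)) * norm (y i)"])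
        (auto intro!: tendsto_intros d(1))
    then have "c * (d * (n + 1)) \<le> c * (2 * norm x)"
      by (simp add: algebra_simps)
    then show ?thesis
      using c(1) by simp
  qed
  have "d \<le> 0"
  proof (rule ccontr)
    assume "\<not> d \<le> 0"
    then obtain n :: nat where "2 * norm x < n * d"
      using ex_less_of_nat_mult[of d "2 * norm x"] by auto
    then show False
      using bound[of n] \<open>\<not> d \<le> 0\<close> by (simp add: algebra_simps)
  qed
  moreover have "d \<ge> 0"
    by (rule LIMSEQ_le_const[OF d(1)]) auto
  ultimately have "(\<lambda>i. norm (y i)) \<longlonglongrightarrow> 0"
    using d(1) by simp
  then have "y \<longlonglongrightarrow> 0"
    by (rule tendsto_norm_zero_cancel)
  then have "(\<lambda>n. (1 - r) *\<^sub>R y n) \<longlonglongrightarrow> (1 - r) *\<^sub>R 0"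
    by (intro tendsto_intros)
  then show ?thesis
    by (simp add: y_def h algebra_simps)
qed

text \<open>This is class (D) over the reals: \<open>T = r I + (1 - r) S\<close> with a contraction \<open>S\<close>.\<close>

definition averaged :: "('v::real_normed_vector \<Rightarrow>\<^sub>L 'v) \<Rightarrow> bool" where
  "averaged T \<longleftrightarrow> (\<exists>r. 0 < r \<and> r < 1 \<and> norm (T - r *\<^sub>R id_blinfun) \<le> 1 - r)"

lemma averaged_contraction:
  fixes T :: "'a::real_normed_vector \<Rightarrow>\<^sub>L 'a"
  assumes "norm (T - r *\<^sub>R id_blinfun) \<le> 1 - r" "0 \<le> r"
  shows "norm T \<le> 1"
  using norm_triangle_ineq[of "T - r *\<^sub>R id_blinfun" "r *\<^sub>R id_blinfun"]
    mult_left_mono[OF norm_id_blinfun_le[where 'v = 'a] assms(2)] assms by simp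

lemma averaged_compose:
  assumes "averaged A" "averaged B"
  shows "averaged (A o\<^sub>L B)"
proof -
  obtain r s where r: "0 < r" "r < 1" "norm (A - r *\<^sub>R id_blinfun) \<le> 1 - r"
    and s: "0 < s" "s < 1" "norm (B - s *\<^sub>R id_blinfun) \<le> 1 - s"
    using assms by (auto simp: averaged_def)
  have "(A o\<^sub>L B) - (r * s) *\<^sub>R id_blinfun
      = ((A - r *\<^sub>R id_blinfun) o\<^sub>L B) + r *\<^sub>R (B - s *\<^sub>R id_blinfun)"
    by (rule blinfun_eqI) (simp add: blinfun.bilinear_simps algebra_simps)
  then have "norm ((A o\<^sub>L B) - (r * s) *\<^sub>R id_blinfun)
      \<le> norm ((A - r *\<^sub>R id_blinfun) o\<^sub>L B) + r * norm (B - s *\<^sub>R id_blinfun)"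
    using norm_triangle_ineq r(1) by (metis abs_of_pos norm_scaleR)
  also have "\<dots> \<le> (1 - r) * 1 + r * (1 - s)"
    using r s averaged_contraction[OF s(3)]
    by (intro add_mono mult_left_mono order_trans[OF norm_blinfun_compose] mult_mono) auto
  finally have "norm ((A o\<^sub>L B) - (r * s) *\<^sub>R id_blinfun) \<le> 1 - r * s"
    by (simp add: algebra_simps)
  moreover have "0 < r * s" "r * s < 1"
    using r s mult_strict_mono[of r 1 s 1] by auto
  ultimately show ?thesis
    unfolding averaged_def by blast
qed

lemma convex_averaged: "convex {T :: 'v::real_normed_vector \<Rightarrow>\<^sub>L 'v. averaged T}"
proof (rule convexI)
  fix A B :: "'v \<Rightarrow>\<^sub>L 'v" and u v :: real
  assume "A \<in> {T. averaged T}" "B \<in> {T. averaged T}" and u: "0 \<le> u" "0 \<le> v" "u + v = 1"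
  then obtain r s where r: "0 < r" "r < 1" "norm (A - r *\<^sub>R id_blinfun) \<le> 1 - r"
    and s: "0 < s" "s < 1" "norm (B - s *\<^sub>R id_blinfun) \<le> 1 - s"
    by (auto simp: averaged_def)
  have "u *\<^sub>R A + v *\<^sub>R B - (u * r + v * s) *\<^sub>R id_blinfun
      = u *\<^sub>R (A - r *\<^sub>R id_blinfun) + v *\<^sub>R (B - s *\<^sub>R id_blinfun)"
    by (simp add: algebra_simps)
  then have "norm (u *\<^sub>R A + v *\<^sub>R B - (u * r + v * s) *\<^sub>R id_blinfun)
      \<le> u * norm (A - r *\<^sub>R id_blinfun) + v * norm (B - s *\<^sub>R id_blinfun)"
    using norm_triangle_ineq[of "u *\<^sub>R (A - r *\<^sub>R id_blinfun)" "v *\<^sub>R (B - s *\<^sub>R id_blinfun)"] u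
    by simp
  also have "\<dots> \<le> u * (1 - r) + v * (1 - s)"
    using r s u by (intro add_mono mult_left_mono) auto
  also have "\<dots> = 1 - (u * r + v * s)"
    using u(3) by (simp add: algebra_simps)
  finally have "norm (u *\<^sub>R A + v *\<^sub>R B - (u * r + v * s) *\<^sub>R id_blinfun) \<le> 1 - (u * r + v * s)" .
  moreover have "0 < u * r + v * s" "u * r + v * s < 1"
  proof -
    have "u > 0 \<or> v > 0"
      using u by linarith
    then have "0 < u * r + v * s \<and> 0 < u * (1 - r) + v * (1 - s)"
      using r s u by (auto intro: add_pos_nonneg add_nonneg_pos)
    then show "0 < u * r + v * s" "u * r + v * s < 1"
      using \<open>u * (1 - r) + v * (1 - s) = 1 - (u * r + v * s)\<close> by auto
  qed
  ultimately show "u *\<^sub>R A + v *\<^sub>R B \<in> {T. averaged T}"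
    unfolding averaged_def by blast
qed

lemma averaged_blinfun_regular:
  assumes "averaged T"
  shows "(\<lambda>n. (blinfun_apply T ^^ n) x - (blinfun_apply T ^^ Suc n) x) \<longlonglongrightarrow> 0"
proof -
  obtain r where r: "0 < r" "r < 1" "norm (T - r *\<^sub>R id_blinfun) \<le> 1 - r"
    using assms by (auto simp: averaged_def)
  define S where "S = (1 / (1 - r)) *\<^sub>R (T - r *\<^sub>R id_blinfun)"
  have "norm S \<le> 1"
    using r by (simp add: S_def)
  then show ?thesis
    using r by (intro averaged_regular[of "blinfun_apply S" r] linear_blinfun_apply norm_blinfun_contraction)
      (auto simp: S_def blinfun.bilinear_simps)
qed

section \<open>Reflexivity\<close>

text \<open>Functionals on the underlying real space suffice for the ergodic argument, and for them
  the type of bounded linear maps is itself the dual space.\<close>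

definition real_reflexive :: "'v::real_normed_vector itself \<Rightarrow> bool" where
  "real_reflexive _ \<longleftrightarrow>
    (\<forall>\<Phi> :: ('v \<Rightarrow>\<^sub>L real) \<Rightarrow>\<^sub>L real. \<exists>x. \<forall>f. blinfun_apply \<Phi> f = blinfun_apply f x)"

text \<open>The point \<open>y\<close> represents an extension to all functionals \<open>f\<close> of the limit of
  \<open>f (T\<^sup>n x)\<close>, a Banach limit in disguise. The limit exists and is \<open>0\<close> at \<open>f \<circ> T - f\<close> by
  asymptotic regularity, so \<open>T y = y\<close>; and it is \<open>f x\<close> if \<open>f\<close> vanishes on the range
  of \<open>I - T\<close>, so no functional separates \<open>x - y\<close> from the closure of that range.\<close>

lemma ergodic_reflexive:
  fixes T :: "'v::real_normed_vector \<Rightarrow>\<^sub>L 'v"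
  assumes refl: "real_reflexive TYPE('v)" and T: "norm T \<le> 1"
    and regular: "(\<lambda>n. (blinfun_apply T ^^ n) x - (blinfun_apply T ^^ Suc n) x) \<longlonglongrightarrow> 0"
  obtains y where "blinfun_apply T y = y" "x - y \<in> closure (range (\<lambda>z. z - blinfun_apply T z))"
proof -
  let ?R = "range (\<lambda>z. z - blinfun_apply T z)"
  define G0 where
    "G0 = {(f :: 'v \<Rightarrow>\<^sub>L real, l). (\<lambda>n. blinfun_apply f ((blinfun_apply T ^^ n) x)) \<longlonglongrightarrow> l}"
  have "subspace G0"
    unfolding G0_def
    by (rule subspaceI)
      (auto simp: zero_prod_def blinfun.add_left blinfun.scaleR_left intro!: tendsto_intros)
  moreover have "l \<le> norm x * norm f" if "(f, l) \<in> G0" for f l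
  proof (rule LIMSEQ_le_const2)
    show "(\<lambda>n. blinfun_apply f ((blinfun_apply T ^^ n) x)) \<longlonglongrightarrow> l"
      using that by (simp add: G0_def)
    have "blinfun_apply f ((blinfun_apply T ^^ n) x) \<le> norm x * norm f" for n
    proof -
      have "blinfun_apply f ((blinfun_apply T ^^ n) x) \<le> norm f * norm ((blinfun_apply T ^^ n) x)"
        using norm_blinfun[of f "(blinfun_apply T ^^ n) x"] by simp
      also have "\<dots> \<le> norm f * norm x"
        by (intro mult_left_mono norm_funpow_le norm_blinfun_contraction T) auto
      finally show ?thesis
        by (simp add: mult.commute)
    qed
    then show "\<exists>N. \<forall>n\<ge>N. blinfun_apply f ((blinfun_apply T ^^ n) x) \<le> norm x * norm f"
      by blast
  qed
  ultimately obtain \<Phi> where "norm \<Phi> \<le> norm x" and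
    \<Phi>: "\<And>f l. (f, l) \<in> G0 \<Longrightarrow> blinfun_apply \<Phi> f = l"
    using bounded_extension[of "norm x" G0] by auto
  obtain y where y: "\<And>f. blinfun_apply \<Phi> f = blinfun_apply f y"
    using refl unfolding real_reflexive_def by blast
  show ?thesis
  proof (rule that)
    show "blinfun_apply T y = y"
    proof (rule functionals_separate_points)
      fix f :: "'v \<Rightarrow>\<^sub>L real"
      have "(\<lambda>n. blinfun_apply f (- ((blinfun_apply T ^^ n) x - (blinfun_apply T ^^ Suc n) x)))
          \<longlonglongrightarrow> blinfun_apply f (- 0)"
        by (intro tendsto_intros regular)
      then have "((f o\<^sub>L T) - f, 0) \<in> G0"
        by (simp add: G0_def blinfun.bilinear_simps)
      then have "blinfun_apply ((f o\<^sub>L T) - f) y = 0"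
        using \<Phi> y by metis
      then show "blinfun_apply f (blinfun_apply T y) = blinfun_apply f y"
        by (simp add: blinfun.diff_left)
    qed
    show "x - y \<in> closure ?R"
    proof (rule ccontr)
      assume "x - y \<notin> closure ?R"
      moreover have "subspace ?R"
        by (intro linear_subspace_image[of _ UNIV, simplified] linear_compose_sub
            linear_id[unfolded id_def] linear_blinfun_apply)
      ultimately obtain f :: "'v \<Rightarrow>\<^sub>L real" where
        f: "\<And>v. v \<in> closure ?R \<Longrightarrow> blinfun_apply f v = 0" "blinfun_apply f (x - y) \<noteq> 0"
        using separating_functional[OF subspace_closure closed_closure] by metis
      have "blinfun_apply f ((blinfun_apply T ^^ n) x) = blinfun_apply f x" for n
      proof -
        have "blinfun_apply f (x - (blinfun_apply T ^^ n) x) = 0"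
          by (intro f(1) subsetD[OF closure_subset] blinfun_funpow_diff_in_range)
        then show ?thesis
          by (simp add: blinfun.diff_right)
      qed
      then have "(f, blinfun_apply f x) \<in> G0"
        by (simp add: G0_def)
      then have "blinfun_apply f y = blinfun_apply f x"
        using \<Phi> y by metis
      then show False
        using f(2) by (simp add: blinfun.diff_right)
    qed
  qed
qed

lemma riesz_almost_orthogonal:
  fixes M :: "'v::real_normed_vector set"
  assumes M: "subspace M" "closed M" "M \<noteq> UNIV" and d: "0 < d" "d < 1"
  obtains u where "norm u = 1" "\<And>m. m \<in> M \<Longrightarrow> 1 - d < norm (u - m)"
proof -
  obtain z where z: "z \<notin> M"
    using M(3) by blast
  have ne: "M \<noteq> {}"
    using subspace_0[OF M(1)] by blast
  define D where "D = infdist z M"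
  have D: "D > 0"
    using infdist_pos_not_in_closed[OF M(2) ne z] by (simp add: D_def)
  have "D < D / (1 - d)"
    using D d by (simp add: field_simps)
  have "\<exists>m0\<in>M. dist z m0 < D / (1 - d)"
  proof (rule ccontr)
    assume "\<not> ?thesis"
    then have "D / (1 - d) \<le> infdist z M"
      unfolding infdist_notempty[OF ne] using ne by (intro cINF_greatest) auto
    then show False
      using \<open>D < D / (1 - d)\<close> by (simp add: D_def)
  qed
  then obtain m0 where m0: "m0 \<in> M" "dist z m0 < D / (1 - d)"
    by blast
  define t where "t = norm (z - m0)"
  have t: "t > 0" "t < D / (1 - d)"
    using m0 z by (auto simp: t_def dist_norm)
  show ?thesis
  proof (rule that)
    show "norm ((z - m0) /\<^sub>R t) = 1"
      using t(1) by (simp add: t_def)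
    fix m assume m: "m \<in> M"
    have "m0 + t *\<^sub>R m \<in> M"
      by (intro subspace_add subspace_scale M m m0)
    then have "D \<le> norm (z - (m0 + t *\<^sub>R m))"
      unfolding D_def dist_norm[symmetric] by (rule infdist_le)
    also have "z - (m0 + t *\<^sub>R m) = t *\<^sub>R ((z - m0) /\<^sub>R t - m)"
      using t(1) by (simp add: scaleR_diff_right)
    finally have "D \<le> t * norm ((z - m0) /\<^sub>R t - m)"
      using t(1) by simp
    moreover have "t * (1 - d) < D"
      using t(2) d by (simp add: pos_less_divide_eq)
    ultimately have "t * (1 - d) < t * norm ((z - m0) /\<^sub>R t - m)"
      by linarith
    then show "1 - d < norm ((z - m0) /\<^sub>R t - m)"
      using t(1) by simp
  qed
qed

text \<open>A Milman--Pettis argument on the predual side. If the canonical image \<open>J X\<close> were a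
  proper closed subspace of the bidual, Riesz's lemma would give a unit \<open>\<Phi>\<close> at distance almost \<open>1\<close>
  from it. Choose \<open>f\<close> in the dual ball with \<open>\<Phi> f \<approx> 1\<close> and a unit \<open>x\<close> with \<open>f x \<approx> 1\<close>. The
  restriction of \<open>\<Phi>\<close> to the kernel of \<open>J x\<close> still has norm almost \<open>1\<close>: a norm-preserving
  extension of it differs from \<open>\<Phi>\<close> by a multiple of \<open>J x\<close>. This gives \<open>g\<close> in the dual ball
  with \<open>\<Phi> g \<approx> 1\<close> and \<open>g x = 0\<close>. Now \<open>\<parallel>f + g\<parallel> \<approx> 2\<close>, yet \<open>\<parallel>f - g\<parallel> \<ge> f x \<approx> 1\<close>, against uniform
  convexity.\<close>

lemma real_reflexive_if_dual_uniformly_convex: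
  assumes uc: "uniformly_convex_space TYPE('v::banach \<Rightarrow>\<^sub>L real)"
  shows "real_reflexive TYPE('v)"
proof -
  define J :: "'v \<Rightarrow> ('v \<Rightarrow>\<^sub>L real) \<Rightarrow>\<^sub>L real" where "J x = Blinfun (\<lambda>f. blinfun_apply f x)" for x
  have J: "blinfun_apply (J x) f = blinfun_apply f x" for x f
    unfolding J_def by (simp add: bounded_linear_Blinfun_apply blinfun.bounded_linear_left)
  have J_le: "norm (J x) \<le> norm x" for x
  proof (rule norm_blinfun_bound)
    show "norm (blinfun_apply (J x) f) \<le> norm x * norm f" for f
      using norm_blinfun[of f x] by (simp add: J mult.commute)
  qed simp
  have J_ge: "norm x \<le> norm (J x)" for x
  proof -
    obtain f :: "'v \<Rightarrow>\<^sub>L real" where f: "norm f \<le> 1" "blinfun_apply f x = norm x"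
      using norming_functional .
    have "norm x \<le> norm (J x) * norm f"
      using norm_blinfun[of "J x" f] f(2) by (simp add: J)
    then show ?thesis
      using mult_left_mono[OF f(1) norm_ge_zero[of "J x"]] by simp
  qed
  have blJ: "bounded_linear J"
    by (rule bounded_linear_intro[of _ 1])
      (auto intro!: blinfun_eqI simp: J blinfun.bilinear_simps J_le)
  have "subspace (range J)"
    using linear_subspace_image[OF bounded_linear.linear[OF blJ] subspace_UNIV] .
  moreover have "complete (range J)"
    by (rule complete_isometric_image[of 1]) (use blJ J_ge in auto)
  then have "closed (range J)"
    by (rule complete_imp_closed)
  ultimately have onto: "range J = UNIV"
  proof (rule_tac ccontr)
    assume ran: "subspace (range J)" "closed (range J)" "range J \<noteq> UNIV"
    obtain s where s: "s > 0" "\<And>f g :: 'v \<Rightarrow>\<^sub>L real.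
        \<lbrakk>norm f \<le> 1; norm g \<le> 1; norm (f + g) > 2 - s\<rbrakk> \<Longrightarrow> norm (f - g) < 1/2"
      using uniformly_convexD[OF uc, of "1/2"] by auto
    define d where "d = min (1/2) (s/2)"
    have d: "0 < d" "d < 1" "d \<le> 1/2" "2 * d \<le> s"
      using s(1) by (auto simp: d_def)
    obtain \<Phi> where \<Phi>: "norm \<Phi> = 1" "\<And>x. 1 - d < norm (\<Phi> - J x)"
      using riesz_almost_orthogonal[OF ran d(1,2)] by (metis rangeI)
    obtain f where f: "norm f = 1" "1 - d < blinfun_apply \<Phi> f"
      using functional_almost_norming[of "1 - d" \<Phi>] \<Phi>(1) d by auto
    obtain x where x: "norm x = 1" "1 - d < blinfun_apply f x"
      using functional_almost_norming[of "1 - d" f] f(1) d by auto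
    have "\<exists>g. blinfun_apply g x = 0 \<and> (1 - d) * norm g < blinfun_apply \<Phi> g"
    proof (rule ccontr)
      assume contra: "\<not> ?thesis"
      define G0 where "G0 = {(g, blinfun_apply \<Phi> g) |g. blinfun_apply g x = 0}"
      have "subspace G0"
        unfolding G0_def by (rule subspaceI) (auto simp: zero_prod_def blinfun.bilinear_simps)
      moreover have "r \<le> (1 - d) * norm g" if "(g, r) \<in> G0" for g r
        using that contra by (fastforce simp: G0_def not_less)
      ultimately obtain \<Psi> where \<Psi>: "norm \<Psi> \<le> 1 - d" "\<And>g r. (g, r) \<in> G0 \<Longrightarrow> blinfun_apply \<Psi> g = r"
        using bounded_extension[of "1 - d" G0] d by auto
      define c where "c = (blinfun_apply \<Phi> f - blinfun_apply \<Psi> f) / blinfun_apply f x"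
      have fx: "blinfun_apply f x \<noteq> 0"
        using x(2) d by auto
      have "\<Phi> - J (c *\<^sub>R x) = \<Psi>"
      proof (rule blinfun_eqI)
        fix g
        define a where "a = blinfun_apply g x / blinfun_apply f x"
        have "blinfun_apply (g - a *\<^sub>R f) x = 0"
          using fx by (simp add: a_def blinfun.bilinear_simps)
        then have "blinfun_apply \<Psi> (g - a *\<^sub>R f) = blinfun_apply \<Phi> (g - a *\<^sub>R f)"
          by (intro \<Psi>(2)) (auto simp: G0_def)
        then have "blinfun_apply \<Psi> g = blinfun_apply \<Phi> g - a * (blinfun_apply \<Phi> f - blinfun_apply \<Psi> f)"
          by (simp add: blinfun.bilinear_simps algebra_simps)
        then show "blinfun_apply (\<Phi> - J (c *\<^sub>R x)) g = blinfun_apply \<Psi> g"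
          by (simp add: J blinfun.bilinear_simps a_def c_def)
      qed
      then show False
        using \<Phi>(2)[of "c *\<^sub>R x"] \<Psi>(1) by simp
    qed
    then obtain g0 where g0: "blinfun_apply g0 x = 0" "(1 - d) * norm g0 < blinfun_apply \<Phi> g0"
      by blast
    then have "norm g0 > 0"
      by (auto simp: blinfun.zero_right)
    define g where "g = g0 /\<^sub>R norm g0"
    have g: "norm g = 1" "blinfun_apply g x = 0" "1 - d < blinfun_apply \<Phi> g"
      using g0 \<open>norm g0 > 0\<close> by (simp_all add: g_def blinfun.bilinear_simps field_simps)
    have "blinfun_apply \<Phi> (f + g) \<le> norm (f + g)"
      using norm_blinfun[of \<Phi> "f + g"] \<Phi>(1) by simp
    then have "norm (f - g) < 1/2"
      using f g d by (intro s(2)) (auto simp: blinfun.add_right)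
    moreover have "blinfun_apply (f - g) x \<le> norm (f - g)"
      using norm_blinfun[of "f - g" x] x(1) by simp
    ultimately show False
      using x(2) g(2) d by (simp add: blinfun.diff_left)
  qed
  show ?thesis
    unfolding real_reflexive_def
  proof
    fix \<Phi> :: "('v \<Rightarrow>\<^sub>L real) \<Rightarrow>\<^sub>L real"
    obtain x where "\<Phi> = J x"
      using onto by blast
    then show "\<exists>x. \<forall>f. blinfun_apply \<Phi> f = blinfun_apply f x"
      using J by auto
  qed
qed

lemma scaleC_eq: "c *\<^sub>C x = Re c *\<^sub>R x + Im c *\<^sub>R (\<i> *\<^sub>C x)"
  for x :: "'a::complex_normed_vector"
proof -
  have "c *\<^sub>C x = (complex_of_real (Re c) + complex_of_real (Im c) * \<i>) *\<^sub>C x"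
    by (subst complex_eq[of c]) (simp add: mult.commute)
  also have "\<dots> = Re c *\<^sub>R x + Im c *\<^sub>R (\<i> *\<^sub>C x)"
    unfolding scaleC_add_left scaleC_scaleC[symmetric] scaleC_of_real ..
  finally show ?thesis .
qed

lemma scaleC_scaleR: "c *\<^sub>C (r *\<^sub>R x) = r *\<^sub>R (c *\<^sub>C x)"
  for x :: "'a::complex_normed_vector"
  unfolding scaleC_of_real[symmetric] scaleC_scaleC by (simp add: mult.commute)

lemma bounded_linear_scaleC: "bounded_linear (\<lambda>x :: 'a::complex_normed_vector. c *\<^sub>C x)"
  by (rule bounded_linear_intro[of _ "cmod c"])
    (auto simp: scaleC_add_right scaleC_scaleR norm_scaleC mult.commute)

text \<open>A complex functional \<open>F\<close> is determined by its real part, \<open>F = Re F - \<i> Re (\<i> F)\<close>. Accordingly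
  a real \<open>\<Phi>\<close> on real functionals is the real part of the complex functional
  \<open>F \<mapsto> \<Phi> (Re F) - \<i> \<Phi> (Re (\<i> F))\<close> on the complex dual, and every real \<open>f\<close> is the real part of
  \<open>y \<mapsto> f y - \<i> f (\<i> y)\<close>.\<close>

lemma real_reflexive_if_reflexive:
  assumes refl: "reflexive_space TYPE('a::complex_normed_vector)"
  shows "real_reflexive TYPE('a)"
  unfolding real_reflexive_def
proof
  fix \<Phi> :: "('a \<Rightarrow>\<^sub>L real) \<Rightarrow>\<^sub>L real"
  define R :: "complex \<Rightarrow>\<^sub>L real" where "R = Blinfun Re"
  have R: "blinfun_apply R z = Re z" for z
    by (simp add: R_def bounded_linear_Blinfun_apply bounded_linear_Re)
  define \<phi> where "\<phi> F = blinfun_apply \<Phi> (R o\<^sub>L F)" for F :: "'a \<Rightarrow>\<^sub>L complex"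
  define \<Psi> where "\<Psi> F = Complex (\<phi> F) (- \<phi> (blinfun_mult_right \<i> o\<^sub>L F))" for F
  have \<phi>_add: "\<phi> (F + G) = \<phi> F + \<phi> G" for F G
  proof -
    have "R o\<^sub>L (F + G) = (R o\<^sub>L F) + (R o\<^sub>L G)"
      by (rule blinfun_eqI) (simp add: blinfun.bilinear_simps)
    then show ?thesis
      by (simp add: \<phi>_def blinfun.add_right)
  qed
  have \<phi>_mult: "\<phi> (blinfun_mult_right c o\<^sub>L F)
      = Re c * \<phi> F + Im c * \<phi> (blinfun_mult_right \<i> o\<^sub>L F)" for c F
  proof -
    have "R o\<^sub>L (blinfun_mult_right c o\<^sub>L F)
        = Re c *\<^sub>R (R o\<^sub>L F) + Im c *\<^sub>R (R o\<^sub>L (blinfun_mult_right \<i> o\<^sub>L F))"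
      by (rule blinfun_eqI) (simp add: blinfun.bilinear_simps R)
    then show ?thesis
      by (simp add: \<phi>_def blinfun.bilinear_simps)
  qed
  have \<phi>_le: "\<bar>\<phi> F\<bar> \<le> norm \<Phi> * norm R * norm F" for F
  proof -
    have "\<bar>\<phi> F\<bar> \<le> norm \<Phi> * norm (R o\<^sub>L F)"
      using norm_blinfun[of \<Phi> "R o\<^sub>L F"] by (simp add: \<phi>_def)
    also have "\<dots> \<le> norm \<Phi> * (norm R * norm F)"
      by (intro mult_left_mono norm_blinfun_compose) auto
    finally show ?thesis
      by (simp add: mult.assoc)
  qed
  have "bidual_functional \<Psi>"
    unfolding bidual_functional_def
  proof (intro conjI ballI allI)
    fix F G :: "'a \<Rightarrow>\<^sub>L complex"
    have "blinfun_mult_right \<i> o\<^sub>L (F + G) = (blinfun_mult_right \<i> o\<^sub>L F) + (blinfun_mult_right \<i> o\<^sub>L G)"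
      by (rule blinfun_eqI) (simp add: blinfun.bilinear_simps distrib_left)
    then show "\<Psi> (F + G) = \<Psi> F + \<Psi> G"
      by (simp add: \<Psi>_def \<phi>_add complex_eq_iff)
  next
    fix c and F :: "'a \<Rightarrow>\<^sub>L complex"
    have "blinfun_mult_right \<i> o\<^sub>L (blinfun_mult_right c o\<^sub>L F) = blinfun_mult_right (\<i> * c) o\<^sub>L F"
      by (rule blinfun_eqI) simp
    then show "\<Psi> (blinfun_mult_right c o\<^sub>L F) = c * \<Psi> F"
      by (simp add: \<Psi>_def \<phi>_mult[of c] \<phi>_mult[of "\<i> * c"] complex_eq_iff)
  next
    have "cmod (\<Psi> F) \<le> (norm \<Phi> * norm R + norm \<Phi> * norm R * norm (blinfun_mult_right \<i>)) * norm F" for F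
    proof -
      have "cmod (\<Psi> F) \<le> \<bar>\<phi> F\<bar> + \<bar>\<phi> (blinfun_mult_right \<i> o\<^sub>L F)\<bar>"
        using cmod_le[of "\<Psi> F"] by (simp add: \<Psi>_def)
      also have "\<dots> \<le> norm \<Phi> * norm R * norm F
          + norm \<Phi> * norm R * (norm (blinfun_mult_right \<i> :: complex \<Rightarrow>\<^sub>L complex) * norm F)"
        by (intro add_mono order_trans[OF \<phi>_le] mult_left_mono norm_blinfun_compose order_refl) auto
      finally show ?thesis
        by (simp add: algebra_simps)
    qed
    then show "\<exists>K. \<forall>F\<in>complex_dual. cmod (\<Psi> F) \<le> K * norm F"
      by blast
  qed
  then obtain x where x: "\<And>F. F \<in> complex_dual \<Longrightarrow> \<Psi> F = blinfun_apply F x"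
    using refl unfolding reflexive_space_def by blast
  have "blinfun_apply \<Phi> f = blinfun_apply f x" for f
  proof -
    define F where "F = Blinfun (\<lambda>y. Complex (blinfun_apply f y) (- blinfun_apply f (\<i> *\<^sub>C y)))"
    have "bounded_linear (\<lambda>y. Complex (blinfun_apply f y) (- blinfun_apply f (\<i> *\<^sub>C y)))"
      unfolding Complex_eq
      by (intro bounded_linear_add bounded_linear_const_mult
          bounded_linear_compose[OF bounded_linear_of_real] bounded_linear_minus
          bounded_linear_compose[OF blinfun.bounded_linear_right bounded_linear_scaleC]
          blinfun.bounded_linear_right)
    then have F: "blinfun_apply F y = Complex (blinfun_apply f y) (- blinfun_apply f (\<i> *\<^sub>C y))" for y
      by (simp add: F_def bounded_linear_Blinfun_apply)
    have "blinfun_apply F (c *\<^sub>C y) = c *\<^sub>C blinfun_apply F y" for c y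
    proof -
      have "\<i> *\<^sub>C c *\<^sub>C y = Re c *\<^sub>R (\<i> *\<^sub>C y) - Im c *\<^sub>R y"
        using scaleC_eq[of "\<i> * c" y] by (simp add: scaleC_scaleC)
      then show ?thesis
        unfolding F scaleC_complex_def
        by (simp add: scaleC_eq[of c y] blinfun.bilinear_simps complex_eq_iff)
    qed
    then have "F \<in> complex_dual"
      by (simp add: complex_dual_def complex_linear_op_def)
    have "R o\<^sub>L F = f"
      by (rule blinfun_eqI) (simp add: R F)
    then have "blinfun_apply \<Phi> f = Re (\<Psi> F)"
      by (simp add: \<Psi>_def \<phi>_def)
    also have "\<dots> = blinfun_apply f x"
      by (simp add: x[OF \<open>F \<in> complex_dual\<close>] F)
    finally show ?thesis .
  qed
  then show "\<exists>x. \<forall>f. blinfun_apply \<Phi> f = blinfun_apply f x"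
    by blast
qed

section \<open>The convex multiplicative semigroup\<close>

lemma orthoprojection_idem:
  assumes "orthoprojection P"
  shows "blinfun_apply P (blinfun_apply P x) = blinfun_apply P x"
  using assms by (metis orthoprojection_def blinfun_apply_blinfun_compose)

lemma orthoprojection_range:
  assumes "orthoprojection P"
  shows "range (blinfun_apply P) = {x. blinfun_apply P x = x}"
  using orthoprojection_idem[OF assms] by (auto intro: range_eqI[OF sym])

lemma convex_semigroup_subset:
  assumes "convex S" and "\<And>A B. A \<in> S \<Longrightarrow> B \<in> S \<Longrightarrow> A o\<^sub>L B \<in> S"
    and "\<And>k. k \<in> {1..N} \<Longrightarrow> P k \<in> S"
  shows "convex_semigroup N P \<subseteq> S"
  unfolding convex_semigroup_def
proof (rule hull_minimal[where S = convex])
  have "word_product P (k # w) \<in> S" if "set (k # w) \<subseteq> {1..N}" for k w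
    using that
  proof (induction w arbitrary: k)
    case Nil
    have "P k o\<^sub>L id_blinfun = P k"
      by (rule blinfun_eqI) simp
    then show ?case
      using Nil assms(3) by (simp add: word_product_def)
  next
    case (Cons l w)
    have "word_product P (k # l # w) = P k o\<^sub>L word_product P (l # w)"
      by (simp add: word_product_def)
    moreover have "word_product P (l # w) \<in> S"
      using Cons by auto
    ultimately show ?case
      using Cons.prems assms(2,3) by simp
  qed
  then show "word_product P ` words N \<subseteq> S"
    by (auto simp: words_def neq_Nil_conv)
qed (rule assms)

lemma convex_semigroup_complex_linear:
  fixes P :: "nat \<Rightarrow> 'a::complex_normed_vector \<Rightarrow>\<^sub>L 'a"
  assumes "\<And>k. k \<in> {1..N} \<Longrightarrow> complex_linear_op (P k)" and "T \<in> convex_semigroup N P"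
  shows "complex_linear_op T"
proof -
  have "convex (Collect complex_linear_op :: ('a \<Rightarrow>\<^sub>L 'a) set)"
  proof (rule convexI)
    fix A B :: "'a \<Rightarrow>\<^sub>L 'a" and u v :: real
    assume "A \<in> Collect complex_linear_op" "B \<in> Collect complex_linear_op"
    then show "u *\<^sub>R A + v *\<^sub>R B \<in> Collect complex_linear_op"
      by (simp add: complex_linear_op_def blinfun.bilinear_simps scaleC_add_right scaleC_scaleR)
  qed
  then have "convex_semigroup N P \<subseteq> Collect complex_linear_op"
    by (rule convex_semigroup_subset) (use assms(1) in \<open>auto simp: complex_linear_op_def\<close>)
  then show ?thesis
    using assms(2) by blast
qed

lemma norm_blinfun_compose_le_1:
  "norm A \<le> 1 \<Longrightarrow> norm B \<le> 1 \<Longrightarrow> norm (A o\<^sub>L B) \<le> 1"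
  using norm_blinfun_compose[of A B] mult_mono[of "norm A" 1 "norm B" 1] by simp

lemma convex_semigroup_contraction:
  assumes "\<And>k. k \<in> {1..N} \<Longrightarrow> norm (P k) \<le> 1" and "T \<in> convex_semigroup N P"
  shows "norm T \<le> 1"
proof -
  have "convex_semigroup N P \<subseteq> cball 0 1"
    by (rule convex_semigroup_subset) (use assms(1) norm_blinfun_compose_le_1 in auto)
  then show ?thesis
    using assms(2) by auto
qed

lemma convex_semigroup_strongly_nonexpansive:
  assumes uc: "uniformly_convex_space TYPE('a::complex_normed_vector)"
    and P: "\<And>k. k \<in> {1..N} \<Longrightarrow> orthoprojection (P k)" and T: "T \<in> convex_semigroup N P"
  shows "strongly_nonexpansive (blinfun_apply (T :: 'a \<Rightarrow>\<^sub>L 'a))"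
proof -
  let ?S = "{T :: 'a \<Rightarrow>\<^sub>L 'a. strongly_nonexpansive (blinfun_apply T)}"
  have "convex ?S"
    unfolding convex_alt
  proof (intro ballI allI impI)
    fix A B :: "'a \<Rightarrow>\<^sub>L 'a" and u :: real
    assume A: "A \<in> ?S" and B: "B \<in> ?S" and u: "0 \<le> u \<and> u \<le> 1"
    consider "u = 0" | "u = 1" | "0 < u" "u < 1"
      using u by linarith
    then show "(1 - u) *\<^sub>R A + u *\<^sub>R B \<in> ?S"
      using A B strongly_nonexpansive_convex[of "blinfun_apply A" "blinfun_apply B" "1 - u" u]
      by cases (auto simp: blinfun.add_left[abs_def] blinfun.scaleR_left)
  qed
  then have "convex_semigroup N P \<subseteq> ?S"
  proof (rule convex_semigroup_subset)
    show "A o\<^sub>L B \<in> ?S" if "A \<in> ?S" "B \<in> ?S" for A B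
      using that strongly_nonexpansive_comp[of "blinfun_apply A" "blinfun_apply B"]
      by (simp add: blinfun_compose.rep_eq o_def)
    show "P k \<in> ?S" if "k \<in> {1..N}" for k
    proof -
      have "norm (P k) \<le> 1"
        using P[OF that] by (auto simp: orthoprojection_def)
      then have "strongly_nonexpansive (blinfun_apply (P k))"
        by (intro strongly_nonexpansive_projection[OF uc] linear_blinfun_apply
            norm_blinfun_contraction orthoprojection_idem P that)
      then show ?thesis by simp
    qed
  qed
  then show ?thesis
    using T by blast
qed

text \<open>Passing to adjoints reverses products, which does no harm since the maps with the
  property are closed under composition in either order.\<close>

lemma convex_semigroup_adjoint_strongly_nonexpansive:
  assumes uc: "uniformly_convex_space TYPE('a::complex_normed_vector \<Rightarrow>\<^sub>L real)"
    and P: "\<And>k. k \<in> {1..N} \<Longrightarrow> orthoprojection (P k)" and T: "T \<in> convex_semigroup N P"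
  shows "strongly_nonexpansive (\<lambda>f :: 'a \<Rightarrow>\<^sub>L real. f o\<^sub>L T)"
proof -
  let ?S = "{T :: 'a \<Rightarrow>\<^sub>L 'a. strongly_nonexpansive (\<lambda>f :: 'a \<Rightarrow>\<^sub>L real. f o\<^sub>L T)}"
  have comb: "f o\<^sub>L (u *\<^sub>R A + v *\<^sub>R B) = u *\<^sub>R (f o\<^sub>L A) + v *\<^sub>R (f o\<^sub>L B)"
    for f :: "'a \<Rightarrow>\<^sub>L real" and A B :: "'a \<Rightarrow>\<^sub>L 'a" and u v :: real
    by (rule blinfun_eqI) (simp add: blinfun.bilinear_simps)
  have assoc: "f o\<^sub>L (A o\<^sub>L B) = (f o\<^sub>L A) o\<^sub>L B" for f :: "'a \<Rightarrow>\<^sub>L real" and A B :: "'a \<Rightarrow>\<^sub>L 'a"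
    by (rule blinfun_eqI) simp
  have "convex ?S"
    unfolding convex_alt
  proof (intro ballI allI impI)
    fix A B :: "'a \<Rightarrow>\<^sub>L 'a" and u :: real
    assume A: "A \<in> ?S" and B: "B \<in> ?S" and u: "0 \<le> u \<and> u \<le> 1"
    consider "u = 0" | "u = 1" | "0 < u" "u < 1"
      using u by linarith
    then show "(1 - u) *\<^sub>R A + u *\<^sub>R B \<in> ?S"
      using A B strongly_nonexpansive_convex[of "\<lambda>f. f o\<^sub>L A" "\<lambda>f. f o\<^sub>L B" "1 - u" u]
      by cases (auto simp: comb)
  qed
  then have "convex_semigroup N P \<subseteq> ?S"
  proof (rule convex_semigroup_subset)
    show "A o\<^sub>L B \<in> ?S" if "A \<in> ?S" "B \<in> ?S" for A B
      using that strongly_nonexpansive_comp[of "\<lambda>f. f o\<^sub>L B" "\<lambda>f. f o\<^sub>L A"]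
      by (simp add: assoc)
    show "P k \<in> ?S" if "k \<in> {1..N}" for k
    proof -
      have k: "P k o\<^sub>L P k = P k" "norm (P k) \<le> 1"
        using P[OF that] by (auto simp: orthoprojection_def)
      have "linear (\<lambda>f :: 'a \<Rightarrow>\<^sub>L real. f o\<^sub>L P k)"
        by (rule linearI) (auto intro!: blinfun_eqI simp: blinfun.bilinear_simps)
      moreover have "norm (f o\<^sub>L P k) \<le> norm f" for f :: "'a \<Rightarrow>\<^sub>L real"
        using norm_blinfun_compose[of f "P k"] mult_left_mono[OF k(2) norm_ge_zero[of f]] by simp
      moreover have "(f o\<^sub>L P k) o\<^sub>L P k = f o\<^sub>L P k" for f :: "'a \<Rightarrow>\<^sub>L real"
        by (metis assoc k(1))
      ultimately have "strongly_nonexpansive (\<lambda>f :: 'a \<Rightarrow>\<^sub>L real. f o\<^sub>L P k)"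
        by (intro strongly_nonexpansive_projection[OF uc])
      then show ?thesis by simp
    qed
  qed
  then show ?thesis
    using T by blast
qed

section \<open>The range of the limit\<close>

lemma word_product_contraction:
  "(\<And>k. k \<in> set w \<Longrightarrow> norm (P k) \<le> 1) \<Longrightarrow> norm (word_product P w) \<le> 1"
  by (induction w) (auto simp: word_product_def norm_id_blinfun_le norm_blinfun_compose_le_1)

text \<open>The factor applied first cannot shorten \<open>y\<close>, as the later ones are contractions; by
  class (W') it fixes \<open>y\<close>, and the argument repeats with the next factor.\<close>

lemma class_W'_word_fixed:
  assumes W: "\<And>k. k \<in> set w \<Longrightarrow> class_W' (P k)"
    and "norm (blinfun_apply (word_product P w) y) = norm y"
  shows "\<forall>k\<in>set w. blinfun_apply (P k) y = y"
  using assms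
proof (induction w)
  case (Cons k w)
  let ?z = "blinfun_apply (word_product P w) y"
  have eq: "blinfun_apply (word_product P (k # w)) y = blinfun_apply (P k) ?z"
    by (simp add: word_product_def)
  have Pk: "norm (P k) \<le> 1" "\<And>x. norm (blinfun_apply (P k) x) = norm x \<Longrightarrow> blinfun_apply (P k) x = x"
    using Cons.prems(1)[of k] by (auto simp: class_W'_def)
  have contr: "norm (word_product P w) \<le> 1"
    using Cons.prems(1) by (intro word_product_contraction) (auto simp: class_W'_def)
  have "norm y \<le> norm ?z"
    using Cons.prems(2) norm_blinfun_contraction[OF Pk(1), of ?z] by (simp add: eq)
  then have "norm ?z = norm y"
    using norm_blinfun_contraction[OF contr, of y] by auto
  then have fixed: "\<forall>k\<in>set w. blinfun_apply (P k) y = y"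
    using Cons by auto
  then have "?z = y"
    by (induction w) (auto simp: word_product_def)
  then have "blinfun_apply (P k) y = y"
    using Cons.prems(2) Pk(2)[of y] by (simp add: eq)
  then show ?case
    using fixed by simp
qed simp

lemma word_product_fixed:
  "(\<And>k. k \<in> set w \<Longrightarrow> blinfun_apply (P k) y = y) \<Longrightarrow> blinfun_apply (word_product P w) y = y"
  by (induction w) (auto simp: word_product_def)

text \<open>If \<open>T x = x\<close>, the triangle inequality for the decomposition of \<open>T\<close> is an equality, so no
  word with a positive coefficient shortens \<open>x\<close>.\<close>

lemma range_formula_class_W':
  assumes P: "\<And>k. k \<in> {1..N} \<Longrightarrow> orthoprojection (P k)"
    and W: "\<And>k. k \<in> {1..N} \<Longrightarrow> class_W' (P k)"
    and ran: "range (blinfun_apply Tinf) = {x. blinfun_apply T x = x}"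
  shows "range_formula N P T Tinf"
  unfolding range_formula_def ran
proof (intro allI impI)
  fix m \<alpha> w assume "decomposition N P T m \<alpha> w"
  then have \<alpha>: "\<And>j. j \<in> {1..m} \<Longrightarrow> \<alpha> j > 0" "(\<Sum>j=1..m. \<alpha> j) = 1"
    and w: "\<And>j. j \<in> {1..m} \<Longrightarrow> w j \<noteq> [] \<and> set (w j) \<subseteq> {1..N}"
    and T: "T = (\<Sum>j=1..m. \<alpha> j *\<^sub>R word_product P (w j))"
    by (auto simp: decomposition_def words_def)
  have Tx: "blinfun_apply T x = (\<Sum>j=1..m. \<alpha> j *\<^sub>R blinfun_apply (word_product P (w j)) x)" for x
    unfolding T by (simp add: blinfun.sum_left blinfun.scaleR_left)
  have F: "decomposition_indices m w \<subseteq> {1..N}"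
    unfolding decomposition_indices_def using w by blast
  have "blinfun_apply T x = x \<longleftrightarrow> (\<forall>k\<in>decomposition_indices m w. blinfun_apply (P k) x = x)" for x
  proof
    assume "\<forall>k\<in>decomposition_indices m w. blinfun_apply (P k) x = x"
    then have "blinfun_apply T x = (\<Sum>j=1..m. \<alpha> j *\<^sub>R x)"
      unfolding Tx by (intro sum.cong refl arg_cong2[where f = scaleR] word_product_fixed)
        (auto simp: decomposition_indices_def)
    then show "blinfun_apply T x = x"
      unfolding scaleR_sum_left[symmetric] \<alpha>(2) by simp
  next
    assume x: "blinfun_apply T x = x"
    have le: "norm (blinfun_apply (word_product P (w j)) x) \<le> norm x" if "j \<in> {1..m}" for j
      using P w[OF that] by (intro norm_blinfun_contraction word_product_contraction)
        (auto simp: orthoprojection_def)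
    have eq: "norm (blinfun_apply (word_product P (w j)) x) = norm x" if j: "j \<in> {1..m}" for j
    proof (rule ccontr)
      assume "norm (blinfun_apply (word_product P (w j)) x) \<noteq> norm x"
      then have "norm (blinfun_apply (word_product P (w j)) x) < norm x"
        using le[OF j] by simp
      then have "(\<Sum>j=1..m. \<alpha> j * norm (blinfun_apply (word_product P (w j)) x)) < (\<Sum>j=1..m. \<alpha> j * norm x)"
        using le \<alpha>(1) j by (intro sum_strict_mono_ex1) auto
      also have "\<dots> = norm x"
        unfolding sum_distrib_right[symmetric] \<alpha>(2) by simp
      finally have "norm (blinfun_apply T x) < norm x"
        unfolding Tx using \<alpha>(1)
        by (intro le_less_trans[OF norm_sum]) (simp add: less_imp_le)
      then show False
        using x by simp
    qed
    show "\<forall>k\<in>decomposition_indices m w. blinfun_apply (P k) x = x"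
    proof
      fix k assume "k \<in> decomposition_indices m w"
      then obtain j where j: "j \<in> {1..m}" "k \<in> set (w j)"
        by (auto simp: decomposition_indices_def)
      show "blinfun_apply (P k) x = x"
        using class_W'_word_fixed[of "w j" P x] W w[OF j(1)] eq[OF j(1)] j(2) by blast
    qed
  qed
  moreover have "(\<Inter>k\<in>decomposition_indices m w. range (blinfun_apply (P k)))
      = {x. \<forall>k\<in>decomposition_indices m w. blinfun_apply (P k) x = x}"
    using F orthoprojection_range[OF P] by blast
  ultimately show "{x. blinfun_apply T x = x} = (\<Inter>k\<in>decomposition_indices m w. range (blinfun_apply (P k)))"
    by simp
qed

lemma class_W'_if_uniformly_convex:
  assumes uc: "uniformly_convex_space TYPE('a::complex_normed_vector)"
    and P: "orthoprojection (P :: 'a \<Rightarrow>\<^sub>L 'a)"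
  shows "class_W' P"
proof -
  have P': "complex_linear_op P" "norm P \<le> 1" "\<And>x. blinfun_apply P (blinfun_apply P x) = blinfun_apply P x"
    using P by (auto simp: orthoprojection_def) (metis blinfun_apply_blinfun_compose)
  have sne: "strongly_nonexpansive (blinfun_apply P)"
    by (intro strongly_nonexpansive_projection[OF uc] linear_blinfun_apply norm_blinfun_contraction P')
  have "blinfun_apply P x = x" if x: "norm (blinfun_apply P x) = norm x" for x
  proof -
    define t where "t = 1 / (norm x + 1)"
    have t: "t > 0" "norm (t *\<^sub>R x) \<le> 1"
      by (auto simp: t_def add_nonneg_pos)
    have "norm (t *\<^sub>R x - blinfun_apply P (t *\<^sub>R x)) < e" if "e > 0" for e
    proof -
      obtain d where "d > 0" "\<And>x. norm x \<le> 1 \<Longrightarrow> norm x - norm (blinfun_apply P x) < d \<Longrightarrow>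
          norm (x - blinfun_apply P x) < e"
        using strongly_nonexpansiveD[OF sne \<open>e > 0\<close>] by blast
      moreover have "norm (blinfun_apply P (t *\<^sub>R x)) = norm (t *\<^sub>R x)"
        by (simp add: blinfun.scaleR_right x)
      ultimately show ?thesis
        using t(2) by simp
    qed
    then have "norm (t *\<^sub>R x - blinfun_apply P (t *\<^sub>R x)) \<le> 0"
      using less_irrefl not_less by blast
    then show ?thesis
      using t(1) by (simp add: blinfun.scaleR_right)
  qed
  then show ?thesis
    using P' by (auto simp: class_W'_def)
qed

text \<open>If \<open>P\<close> keeps the norm of the unit vector \<open>u\<close>, the midpoint of \<open>u\<close> and \<open>P u\<close> is a unit
  vector as well, since \<open>P\<close> maps it to \<open>P u\<close>.\<close>

lemma class_W'_if_strictly_convex: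
  assumes sc: "strictly_convex_space TYPE('a::complex_normed_vector)"
    and P: "orthoprojection (P :: 'a \<Rightarrow>\<^sub>L 'a)"
  shows "class_W' P"
proof -
  have P': "complex_linear_op P" "norm P \<le> 1" "\<And>x. blinfun_apply P (blinfun_apply P x) = blinfun_apply P x"
    using P by (auto simp: orthoprojection_def) (metis blinfun_apply_blinfun_compose)
  have unit: "blinfun_apply P u = u" if u: "norm u = 1" "norm (blinfun_apply P u) = 1" for u
  proof (rule ccontr)
    assume "blinfun_apply P u \<noteq> u"
    let ?z = "midpoint u (blinfun_apply P u)"
    have "blinfun_apply P ?z = blinfun_apply P u"
      by (simp add: midpoint_def blinfun.bilinear_simps P'(3) flip: scaleR_2)
    then have "norm ?z \<ge> 1"
      using norm_blinfun_contraction[OF P'(2), of ?z] u(2) by simp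
    moreover have "norm ?z \<le> 1"
      using norm_triangle_ineq[of u "blinfun_apply P u"] u by (simp add: midpoint_def)
    ultimately have "?z \<in> sphere 0 1"
      by simp
    then have "?z extreme_point_of cball 0 1"
      using sc unfolding strictly_convex_space_def by blast
    moreover have "?z \<in> open_segment u (blinfun_apply P u)"
      using \<open>blinfun_apply P u \<noteq> u\<close> by simp
    moreover have "u \<in> cball 0 1" "blinfun_apply P u \<in> cball 0 1"
      using u by simp_all
    ultimately show False
      unfolding extreme_point_of_def by blast
  qed
  have "blinfun_apply P x = x" if x: "norm (blinfun_apply P x) = norm x" for x
  proof (cases "x = 0")
    case False
    then have "blinfun_apply P (x /\<^sub>R norm x) = x /\<^sub>R norm x"
      using x by (intro unit) (simp_all add: blinfun.scaleR_right)
    then show ?thesis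
      using False by (simp add: blinfun.scaleR_right)
  qed (simp add: blinfun.zero_right)
  then show ?thesis
    using P' by (auto simp: class_W'_def)
qed

section \<open>Convergence of the iterates\<close>

lemma orthoprojection_limit:
  fixes T :: "'a::complex_normed_vector \<Rightarrow>\<^sub>L 'a"
  assumes T: "complex_linear_op T" "norm T \<le> 1"
    and conv: "\<And>x. \<exists>y. blinfun_apply T y = y \<and> (\<lambda>n. (blinfun_apply T ^^ n) x) \<longlonglongrightarrow> y"
  obtains Tinf where "orthoprojection Tinf"
    "\<And>x. (\<lambda>n. (blinfun_apply T ^^ n) x) \<longlonglongrightarrow> blinfun_apply Tinf x"
    "range (blinfun_apply Tinf) = {x. blinfun_apply T x = x}"
proof -
  obtain g where Tg: "\<And>x. blinfun_apply T (g x) = g x"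
    and lim: "\<And>x. (\<lambda>n. (blinfun_apply T ^^ n) x) \<longlonglongrightarrow> g x"
    using conv by metis
  have g_eq: "g x = y" if "(\<lambda>n. (blinfun_apply T ^^ n) x) \<longlonglongrightarrow> y" for x y
    using LIMSEQ_unique[OF lim that] .
  note lin = linear_funpow[OF linear_blinfun_apply[of T]]
  have g_le: "norm (g x) \<le> norm x" for x
    by (rule LIMSEQ_le_const2[OF tendsto_norm[OF lim]])
      (auto intro!: norm_funpow_le norm_blinfun_contraction T)
  have "bounded_linear g"
  proof (rule bounded_linear_intro[of _ 1])
    show "g (x + y) = g x + g y" for x y
      by (rule g_eq) (simp add: linear_add[OF lin] tendsto_add lim)
    show "g (r *\<^sub>R x) = r *\<^sub>R g x" for r x
      by (rule g_eq) (simp add: linear_scale[OF lin] tendsto_scaleR lim)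
  qed (simp add: g_le)
  then have app: "blinfun_apply (Blinfun g) = g"
    by (rule bounded_linear_Blinfun_apply)
  have g_fixed: "g x = x" if "blinfun_apply T x = x" for x
    by (rule g_eq) (simp add: funpow_fixed[where h = "blinfun_apply T", OF that])
  show ?thesis
  proof (rule that)
    have "g (c *\<^sub>C x) = c *\<^sub>C g x" for c x
    proof (rule g_eq)
      have "(blinfun_apply T ^^ n) (c *\<^sub>C x) = c *\<^sub>C ((blinfun_apply T ^^ n) x)" for n
        using T(1) by (induction n) (auto simp: complex_linear_op_def)
      then show "(\<lambda>n. (blinfun_apply T ^^ n) (c *\<^sub>C x)) \<longlonglongrightarrow> c *\<^sub>C g x"
        using bounded_linear.tendsto[OF bounded_linear_scaleC lim] by simp
    qed
    moreover have "Blinfun g o\<^sub>L Blinfun g = Blinfun g"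
      by (rule blinfun_eqI) (simp add: app g_fixed Tg)
    moreover have "norm (Blinfun g) \<le> 1"
      by (rule norm_blinfun_bound) (simp_all add: app g_le)
    ultimately show "orthoprojection (Blinfun g)"
      by (simp add: orthoprojection_def complex_linear_op_def app)
    show "(\<lambda>n. (blinfun_apply T ^^ n) x) \<longlonglongrightarrow> blinfun_apply (Blinfun g) x" for x
      by (simp add: app lim)
    show "range (blinfun_apply (Blinfun g)) = {x. blinfun_apply T x = x}"
      unfolding app using Tg g_fixed by (metis (mono_tags, lifting) UNIV_I image_iff mem_Collect_eq subsetI subset_antisym)
  qed
qed

theorem mainTheorem1:
  fixes P :: "nat \<Rightarrow> 'a::complex_banach \<Rightarrow>\<^sub>L 'a" and N :: nat and T :: "'a \<Rightarrow>\<^sub>L 'a"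
  assumes "\<And>k. k \<in> {1..N} \<Longrightarrow> orthoprojection (P k)"
    and "uniformly_convex_space TYPE('a) \<or> uniformly_smooth_space TYPE('a) \<or>
      (reflexive_space TYPE('a) \<and> (\<forall>k\<in>{1..N}. class_D (P k)))"
    and "T \<in> convex_semigroup N P"
  shows "\<exists>Tinf :: 'a \<Rightarrow>\<^sub>L 'a. orthoprojection Tinf \<and>
    (\<forall>x. (\<lambda>n. (blinfun_apply T ^^ n) x) \<longlonglongrightarrow> blinfun_apply Tinf x) \<and>
    ((\<forall>k\<in>{1..N}. class_W' (P k)) \<longrightarrow> range_formula N P T Tinf) \<and>
    (uniformly_convex_space TYPE('a) \<or>
      (uniformly_smooth_space TYPE('a) \<and> strictly_convex_space TYPE('a)) \<longrightarrow>
      range_formula N P T Tinf)"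
proof -
  have T: "complex_linear_op T" "norm T \<le> 1"
    using convex_semigroup_complex_linear[OF _ assms(3)] convex_semigroup_contraction[OF _ assms(3)]
      assms(1) by (auto simp: orthoprojection_def)
  let ?mean_ergodic =
    "\<forall>x. \<exists>y. blinfun_apply T y = y \<and> x - y \<in> closure (range (\<lambda>z. z - blinfun_apply T z))"
  let ?regular = "\<forall>x. (\<lambda>n. (blinfun_apply T ^^ n) x - (blinfun_apply T ^^ Suc n) x) \<longlonglongrightarrow> 0"
  have "?regular \<and> ?mean_ergodic"
    using assms(2)
  proof (elim disjE conjE)
    assume uc: "uniformly_convex_space TYPE('a)"
    have ?regular
      using strongly_nonexpansive_tendsto
        convex_semigroup_strongly_nonexpansive[OF uc assms(1,3)] by blast
    moreover have ?mean_ergodic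
      using ergodic_uniformly_convex[OF uc T(2)] by metis
    ultimately show ?thesis ..
  next
    assume "uniformly_smooth_space TYPE('a)"
    then have uc: "uniformly_convex_space TYPE('a \<Rightarrow>\<^sub>L real)"
      by (rule uniformly_convex_dual)
    have regular: ?regular
      using adjoint_regular convex_semigroup_adjoint_strongly_nonexpansive[OF uc assms(1,3)] by blast
    moreover have ?mean_ergodic
      using ergodic_reflexive[OF real_reflexive_if_dual_uniformly_convex[OF uc] T(2)] regular by metis
    ultimately show ?thesis ..
  next
    assume refl: "reflexive_space TYPE('a)" and D: "\<forall>k\<in>{1..N}. class_D (P k)"
    have "convex_semigroup N P \<subseteq> {T. averaged T}"
    proof (rule convex_semigroup_subset[OF convex_averaged])
      show "A o\<^sub>L B \<in> {T. averaged T}"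
        if "A \<in> {T. averaged T}" "B \<in> {T. averaged T}" for A B :: "'a \<Rightarrow>\<^sub>L 'a"
        using that averaged_compose by blast
      show "P k \<in> {T. averaged T}" if "k \<in> {1..N}" for k
        using D that by (simp add: class_D_def averaged_def)
    qed
    then have regular: ?regular
      using averaged_blinfun_regular assms(3) by blast
    moreover have ?mean_ergodic
      using ergodic_reflexive[OF real_reflexive_if_reflexive[OF refl] T(2)] regular by metis
    ultimately show ?thesis ..
  qed
  then have "\<exists>y. blinfun_apply T y = y \<and> (\<lambda>n. (blinfun_apply T ^^ n) x) \<longlonglongrightarrow> y" for x
    using iterates_tendsto_fixed_point[OF T(2)] by metis
  then obtain Tinf where Tinf: "orthoprojection Tinf"
    "\<And>x. (\<lambda>n. (blinfun_apply T ^^ n) x) \<longlonglongrightarrow> blinfun_apply Tinf x"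
    "range (blinfun_apply Tinf) = {x. blinfun_apply T x = x}"
    using orthoprojection_limit[OF T] by blast
  have "range_formula N P T Tinf" if "\<forall>k\<in>{1..N}. class_W' (P k)"
    by (rule range_formula_class_W'[OF assms(1) _ Tinf(3)]) (use that in auto)
  moreover have "\<forall>k\<in>{1..N}. class_W' (P k)"
    if "uniformly_convex_space TYPE('a) \<or>
      (uniformly_smooth_space TYPE('a) \<and> strictly_convex_space TYPE('a))"
    using that class_W'_if_uniformly_convex class_W'_if_strictly_convex assms(1) by blast
  ultimately show ?thesis
    using Tinf(1,2) by blast
qed

end
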